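(* Let $q$ be a positive integer and let $\mathscr{B}\colon X\to^? q$ be a Borel CSP on a standard Borel space $X$. Suppose that $\mathrm{asi}(G_{\mathscr{B}})\leq 1$. If \[ \mathsf{p}(\mathscr{B})\,(\mathsf{d}(\mathscr{B})+1)^{2}\,\leq\, e^{-2}, \] then $\mathscr{B}$ has a Borel solution $f\colon X\to q$.
   Context: $\mathbb{N}=\{0,1,2,\dots\}$, and $q\in\mathbb{N}$ is identified with $\{0,\dots,q-1\}$. CSPs. Let $X$ be a set and $q$ a positive integer. An $(X,q)$-constraint with domain a finite set $D\subseteq X$ is a set $B\subseteq q^D$ of functions $D\to q$; write $\mathrm{dom}(B)=D$. A function $f\colon X\to q$ violates $B$ if $f|_{\mathrm{dom}(B)}\in B$, and satisfies $B$ otherwise. A constraint satisfaction problem (CSP) $\mathscr{B}\colon X\to^? q$ is a set of $(X,q)$-constraints; a solution to it is a function $f\colon X\to q$ satisfying every $B\in\mathscr{B}$. Put $\mathbb{P}[B]=|B|/q^{|\mathrm{dom}(B)|}$, $\mathsf{p}(\mathscr{B})=\sup_{B\in\mathscr{B}}\mathbb{P}[B]$, and $\mathsf{d}(\mathscr{B})=\sup_{B\in\mathscr{B}}|\{B'\in\mathscr{B}: B'\neq B,\ \mathrm{dom}(B')\cap\mathrm{dom}(B)\neq\varnothing\}|$. Inequalities involving $\mathsf{d}(\mathscr{B})$ are understood to include $\mathsf{d}(\mathscr{B})<\infty$. $G_{\mathscr{B}}$ is the graph with vertex set $X$ in which distinct $x,y$ are adjacent iff some $B\in\mathscr{B}$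 has $x,y\in\mathrm{dom}(B)$. Borel CSPs. For a standard Borel space $X$, the set $[X]^k$ of $k$-element subsets carries the quotient standard Borel structure from the $k$-tuples of distinct points, and the set $[X]^{<\infty}=\bigsqcup_k[X]^k$ of finite subsets carries the disjoint union structure. The set of finite partial functions $X\rightharpoonup q$ (identified with their graphs) is a Borel subset of $[X\times q]^{<\infty}$. The set $\mathrm{Const}(X,q)$ of all $(X,q)$-constraints, viewed as finite sets of finite partial functions $X\rightharpoonup q$ with a common domain, is a Borel subset of the space of finite subsets of that space, hence is standard Borel. A CSP $\mathscr{B}\colon X\to^? q$ is Borel if it is a Borel subset of $\mathrm{Const}(X,q)$. (If $\mathscr{B}$ is Borel and $\mathsf{d}(\mathscr{B})<\infty$, then $G_{\mathscr{B}}$ is a locally finite Borel graph, i.e. its adjacency relation is Borel in $X^2$.) Asymptotic separation index. A graph is component-finite if all its connected components are finite. For a Borel graph $G$, $\mathrm{si}(G)$ is the smallest $s\in\mathbb{N}$ for which there is a partition $V(G)=U_0\sqcup\dots\sqcup U_s$ into $s+1$ Borel sets such that every induced subgraph $G[U_i]$ is component-finite ($\infty$ if no such $s$ exists). For $R\in\mathbb{N}$, $G^R$ is the graph on $V(G)$ in which two distinct vertices are adjacent iff they are joined by a path of at most $R$ edges in $G$. Then $\mathrm{asi}(G)=\sup_{R\in\mathbb{N}}\mathrm{si}(G^R)$. *)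

theory Defs
  imports "HOL-Analysis.Analysis"
begin

section \<open>Standard Borel spaces\<close>

text \<open>
  A measure is used only through its carrier and its sigma-algebra; the measure function plays
  no role anywhere in this theory.
\<close>

definition standard_borel :: "'a measure \<Rightarrow> bool" where
  "standard_borel M \<longleftrightarrow>
     (\<exists>T. topspace T = space M \<and> completely_metrizable_space T \<and> separable_space T \<and>
          sets M = sigma_sets (space M) {U. openin T U})"

definition distinct_tuples :: "'a measure \<Rightarrow> nat \<Rightarrow> (nat \<Rightarrow> 'a) measure" where
  "distinct_tuples M k = restrict_space (PiM {..<k} (\<lambda>_. M)) {x. inj_on x {..<k}}"

text \<open>
  A set of finite subsets is Borel iff for every \<open>k\<close> its part of size \<open>k\<close> is Borel in the
  quotient of the distinct \<open>k\<close>-tuples. These sets already form a sigma-algebra, see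
  \<open>sets_finite_subsets\<close> below.
\<close>

definition finite_subsets :: "'a measure \<Rightarrow> 'a set measure" where
  "finite_subsets M = sigma {S. finite S \<and> S \<subseteq> space M}
     {A. A \<subseteq> {S. finite S \<and> S \<subseteq> space M} \<and>
         (\<forall>k. {x \<in> space (distinct_tuples M k). x ` {..<k} \<in> A} \<in> sets (distinct_tuples M k))}"

lemma space_finite_subsets: "space (finite_subsets M) = {S. finite S \<and> S \<subseteq> space M}"
  unfolding finite_subsets_def by (rule space_measure_of) auto

lemma sets_finite_subsets:
  "sets (finite_subsets M) =
     {A. A \<subseteq> {S. finite S \<and> S \<subseteq> space M} \<and>
         (\<forall>k. {x \<in> space (distinct_tuples M k). x ` {..<k} \<in> A} \<in> sets (distinct_tuples M k))}"
    (is "_ = ?\<A>")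
proof -
  let ?\<Omega> = "{S. finite S \<and> S \<subseteq> space M}"
  have image: "x ` {..<k} \<in> ?\<Omega>" if "x \<in> space (distinct_tuples M k)" for x k
    using that by (auto simp: distinct_tuples_def space_restrict_space space_PiM)
  have "sigma_algebra ?\<Omega> ?\<A>"
    unfolding sigma_algebra_iff2
  proof (intro conjI ballI allI impI)
    fix A assume A: "A \<in> ?\<A>"
    have "{x \<in> space (distinct_tuples M k). x ` {..<k} \<in> ?\<Omega> - A} =
          space (distinct_tuples M k) - {x \<in> space (distinct_tuples M k). x ` {..<k} \<in> A}" for k
      using image by blast
    then show "?\<Omega> - A \<in> ?\<A>" using A by auto
  next
    fix A :: "nat \<Rightarrow> 'a set set" assume A: "range A \<subseteq> ?\<A>"
    have "{x \<in> space (distinct_tuples M k). x ` {..<k} \<in> (\<Union>i. A i)} =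
          (\<Union>i. {x \<in> space (distinct_tuples M k). x ` {..<k} \<in> A i})" for k
      by blast
    moreover have "(\<Union>i. {x \<in> space (distinct_tuples M k). x ` {..<k} \<in> A i})
        \<in> sets (distinct_tuples M k)" for k
      using A by (intro sets.countable_UN) auto
    ultimately have "{x \<in> space (distinct_tuples M k). x ` {..<k} \<in> (\<Union>i. A i)}
        \<in> sets (distinct_tuples M k)" for k
      by metis
    then show "(\<Union>i. A i) \<in> ?\<A>" using A by blast
  qed auto
  then have "sigma_sets ?\<Omega> ?\<A> = ?\<A>" by (rule sigma_algebra.sigma_sets_eq)
  moreover have "sets (finite_subsets M) = sigma_sets ?\<Omega> ?\<A>"
    unfolding finite_subsets_def by (rule sets_measure_of) auto
  ultimately show ?thesis by simp
qed

text \<open>Finite partial functions into \<open>q = {0, \<dots>, q - 1}\<close> are identified with their graphs.\<close>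

definition finite_partial_functions :: "'a measure \<Rightarrow> nat \<Rightarrow> ('a \<rightharpoonup> nat) measure" where
  "finite_partial_functions M q =
     vimage_algebra {p. finite (dom p) \<and> dom p \<subseteq> space M \<and> ran p \<subseteq> {..<q}} Map.graph
       (finite_subsets (M \<Otimes>\<^sub>M count_space {..<q}))"


section \<open>Constraint satisfaction problems\<close>

text \<open>
  A constraint is a set of partial functions with a common finite domain. The domain is recovered
  from the constraint as \<open>constraint_dom\<close>; the empty constraint, which every function satisfies,
  thereby gets the domain \<open>{}\<close>.
\<close>

definition is_constraint :: "'a set \<Rightarrow> nat \<Rightarrow> ('a \<rightharpoonup> nat) set \<Rightarrow> bool" where
  "is_constraint X q B \<longleftrightarrow>
     (\<exists>D. finite D \<and> D \<subseteq> X \<and> (\<forall>p\<in>B. dom p = D \<and> ran p \<subseteq> {..<q}))"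

definition constraint_dom :: "('a \<rightharpoonup> nat) set \<Rightarrow> 'a set" where
  "constraint_dom B = (\<Union>p\<in>B. dom p)"

lemma constraint_dom_eq: "(\<And>p. p \<in> B \<Longrightarrow> dom p = D) \<Longrightarrow> B \<noteq> {} \<Longrightarrow> constraint_dom B = D"
  by (auto simp: constraint_dom_def)

definition violates :: "('a \<Rightarrow> nat) \<Rightarrow> ('a \<rightharpoonup> nat) set \<Rightarrow> bool" where
  "violates f B \<longleftrightarrow> (Some \<circ> f) |` constraint_dom B \<in> B"

definition Const :: "'a measure \<Rightarrow> nat \<Rightarrow> ('a \<rightharpoonup> nat) set measure" where
  "Const M q =
     restrict_space (finite_subsets (finite_partial_functions M q)) {B. is_constraint (space M) q B}"

definition borel_CSP :: "'a measure \<Rightarrow> nat \<Rightarrow> ('a \<rightharpoonup> nat) set set \<Rightarrow> bool" where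
  "borel_CSP M q \<B> \<longleftrightarrow> \<B> \<in> sets (Const M q)"

definition borel_solution ::
    "'a measure \<Rightarrow> nat \<Rightarrow> ('a \<rightharpoonup> nat) set set \<Rightarrow> ('a \<Rightarrow> nat) \<Rightarrow> bool" where
  "borel_solution M q \<B> f \<longleftrightarrow>
     f \<in> M \<rightarrow>\<^sub>M count_space {..<q} \<and> (\<forall>B\<in>\<B>. \<not> violates f B)"

definition constraint_prob :: "nat \<Rightarrow> ('a \<rightharpoonup> nat) set \<Rightarrow> real" where
  "constraint_prob q B = real (card B) / real q ^ card (constraint_dom B)"

definition CSP_p :: "nat \<Rightarrow> ('a \<rightharpoonup> nat) set set \<Rightarrow> ennreal" where
  "CSP_p q \<B> = (SUP B\<in>\<B>. ennreal (constraint_prob q B))"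

text \<open>Counting measure supplies the cardinality, with value \<open>\<infinity>\<close> on infinite sets.\<close>

definition CSP_d :: "('a \<rightharpoonup> nat) set set \<Rightarrow> ennreal" where
  "CSP_d \<B> = (SUP B\<in>\<B>. emeasure (count_space UNIV)
     {B' \<in> \<B>. B' \<noteq> B \<and> constraint_dom B' \<inter> constraint_dom B \<noteq> {}})"


section \<open>Asymptotic separation index\<close>

text \<open>A graph is given by its vertex set (or space) and a symmetric irreflexive relation.\<close>

definition CSP_graph :: "('a \<rightharpoonup> nat) set set \<Rightarrow> 'a rel" where
  "CSP_graph \<B> = {(x, y). x \<noteq> y \<and> (\<exists>B\<in>\<B>. x \<in> constraint_dom B \<and> y \<in> constraint_dom B)}"

definition induced :: "'a rel \<Rightarrow> 'a set \<Rightarrow> 'a rel" where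
  "induced E U = E \<inter> U \<times> U"

definition component_finite :: "'a set \<Rightarrow> 'a rel \<Rightarrow> bool" where
  "component_finite V E \<longleftrightarrow> (\<forall>x\<in>V. finite {y \<in> V. (x, y) \<in> E\<^sup>*})"

text \<open>A walk with \<open>n \<le> R\<close> edges exists iff a path with at most \<open>R\<close> edges does.\<close>

definition graph_power :: "'a rel \<Rightarrow> nat \<Rightarrow> 'a rel" where
  "graph_power E R = {(x, y). x \<noteq> y \<and> (\<exists>n\<le>R. (x, y) \<in> E ^^ n)}"

definition separation_index :: "'a measure \<Rightarrow> 'a rel \<Rightarrow> enat" where
  "separation_index M E =
     (INF s \<in> {s. \<exists>U. (\<forall>i\<le>s. U i \<in> sets M) \<and> disjoint_family_on U {..s} \<and>
                      (\<Union>i\<le>s. U i) = space M \<and>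
                      (\<forall>i\<le>s. component_finite (U i) (induced E (U i)))}. enat s)"

definition asymptotic_separation_index :: "'a measure \<Rightarrow> 'a rel \<Rightarrow> enat" where
  "asymptotic_separation_index M E = (SUP R. separation_index M (graph_power E R))"

end

theory Submission
  imports Defs
begin

text \<open>
  Write \<open>G\<close> for the graph of the CSP, \<open>p\<close> and \<open>d\<close> for its two parameters, and
  \<open>\<tau> = exp (-1) / (d + 1)\<close>, so that the hypothesis says \<open>p \<le> \<tau>\<^sup>2\<close>. The bound on the asymptotic
  separation index, read at distance \<open>R = 1\<close>, splits the space into two Borel sets \<open>U\<close> and \<open>U'\<close>
  such that all components of \<open>G[U]\<close> and \<open>G[U']\<close> are finite. The colours are revealed first on
  \<open>U\<close> and then on \<open>U'\<close>.

  Give \<open>U\<close> uniformly random colours and look at the conditional probability that a constraint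
  \<open>B\<close> is violated. Its mean is at most \<open>\<tau>\<^sup>2\<close>, so by Markov's inequality it reaches \<open>\<tau>\<close> with
  probability at most \<open>\<tau>\<close>. This event depends only on the colours on the part of the domain of
  \<open>B\<close> inside \<open>U\<close>, which is a clique of \<open>G[U]\<close> and hence lies in one finite component.
  The symmetric Lovasz Local Lemma (\<open>finite_local_lemma\<close>), whose condition at dependency
  degree \<open>d\<close> is that each event has probability at most \<open>\<tau>\<close>, therefore colours each component
  of \<open>G[U]\<close> so that all conditional probabilities stay below \<open>\<tau>\<close>. The same argument on \<open>U'\<close>, starting from
  conditional probabilities at most \<open>\<tau>\<close>, brings them below \<open>1\<close>; as everything is revealed by
  then, they are \<open>0\<close> or \<open>1\<close>, so no constraint is violated. Both rounds are
  instances of \<open>colour_one_more_part\<close>.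

  The local solutions must be chosen in a Borel way (\<open>borel_choice_on_finite_components\<close>). There
  is a countable sequence of Borel colourings that realises every colouring of every finite set of
  points. Each point uses the first colouring in this sequence that works on its whole component;
  the index is constant on components, so the result is again good.
  For this function to be Borel, the set of points in the component of some badly coloured
  constraint has to be Borel. It is built from projections of Borel sets of tuples that enumerate
  constraint domains. A point lies in at most \<open>d + 1\<close> domains, so these projections are
  bounded-to-one. That bounded-to-one projections of Borel sets of tuples are Borel
  (\<open>standard_borel_coordinate_image\<close>) is proved from the separation of disjoint analytic
  sets by way of the Lusin-Souslin theorem.
\<close>

section \<open>Separation of analytic sets and injective Borel images\<close>

lemma dense_sequence:
  obtains c :: "nat \<Rightarrow> 'z::{metric_space,second_countable_topology}"
  where "\<And>x e. e > 0 \<Longrightarrow> \<exists>i. dist x (c i) < e"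
proof -
  obtain D :: "'z set" where D: "countable D" "\<And>X. open X \<Longrightarrow> X \<noteq> {} \<Longrightarrow> \<exists>d\<in>D. d \<in> X"
    by (rule countable_dense_setE) blast
  have "\<exists>i. dist x (from_nat_into D i) < e" if "e > 0" for x and e :: real
  proof -
    obtain d where d: "d \<in> D" "d \<in> ball x e"
      using D(2)[of "ball x e"] \<open>e > 0\<close> by (metis centre_in_ball empty_iff open_ball)
    obtain i where "from_nat_into D i = d"
      using from_nat_into_surj[OF D(1) d(1)] by blast
    then show ?thesis using d by (auto simp: dist_commute)
  qed
  then show thesis using that by blast
qed

definition borel_separated :: "'x::topological_space set \<Rightarrow> 'x set \<Rightarrow> bool" where
  "borel_separated A A' \<longleftrightarrow> (\<exists>C\<in>sets borel. A \<subseteq> C \<and> C \<inter> A' = {})"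

lemma borel_separated_UN:
  fixes A A' :: "nat \<Rightarrow> 'x::topological_space set"
  assumes "\<And>i j. borel_separated (A i) (A' j)"
  shows "borel_separated (\<Union>i. A i) (\<Union>j. A' j)"
proof -
  obtain C where C: "\<And>i j. C i j \<in> sets borel" "\<And>i j. A i \<subseteq> C i j" "\<And>i j. C i j \<inter> A' j = {}"
    using assms unfolding borel_separated_def by metis
  have "(\<Union>i. \<Inter>j. C i j) \<in> sets borel"
    using C(1) by blast
  moreover have "(\<Union>i. A i) \<subseteq> (\<Union>i. \<Inter>j. C i j)"
    using C(2) by blast
  moreover have "(\<Union>i. \<Inter>j. C i j) \<inter> (\<Union>j. A' j) = {}"
    using C(3) by blast
  ultimately show ?thesis
    unfolding borel_separated_def by blast
qed

text \<open>
  If the two images were not separated, then for covers of the domain by countably many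
  closed balls of radius \<open>1 / (n + 1)\<close> some pair of pieces would have non-separated images as well
  (\<open>borel_separated_UN\<close>). Iterating over \<open>n\<close> yields shrinking closed sets with limits \<open>a \<in> K\<close> and
  \<open>a' \<in> K'\<close>. But \<open>f a \<noteq> f a'\<close> have disjoint open neighbourhoods, which by continuity do separate
  the images of late pieces.
\<close>

lemma closed_images_separated:
  fixes K K' :: "'w::{complete_space,second_countable_topology} set"
    and f :: "'w \<Rightarrow> 'x::t2_space"
  assumes cl: "closed K" "closed K'" and f: "continuous_on UNIV f"
    and disj: "f ` K \<inter> f ` K' = {}"
  shows "borel_separated (f ` K) (f ` K')"
proof (rule ccontr)
  assume ns: "\<not> borel_separated (f ` K) (f ` K')"
  obtain c :: "nat \<Rightarrow> 'w" where c: "\<And>x e. e > 0 \<Longrightarrow> \<exists>i. dist x (c i) < e"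
    using dense_sequence by blast
  define P where "P = (\<lambda>(L, L'). closed L \<and> closed L' \<and> \<not> borel_separated (f ` L) (f ` L'))"
  define Q where "Q = (\<lambda>n (L, L') (L1, L1').
    \<exists>i j. L1 = L \<inter> cball (c i) (inverse (Suc n)) \<and> L1' = L' \<inter> cball (c j) (inverse (Suc n)))"
  (* one round of the descent: cover both sets by closed balls of radius 1 / (n + 1) *)
  have step: "\<exists>y. P y \<and> Q n x y" if "P x" for n x
  proof -
    obtain L L' where x: "x = (L, L')" by fastforce
    define r where "r = inverse (real (Suc n))"
    have "r > 0" by (simp add: r_def)
    have cover: "(\<Union>i. f ` (S \<inter> cball (c i) r)) = f ` S" for S
    proof -
      have "\<exists>i. z \<in> cball (c i) r" for z
        using c[OF \<open>r > 0\<close>, of z] by (auto simp: dist_commute intro: less_imp_le)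
      then show ?thesis by blast
    qed
    have "\<not> borel_separated (\<Union>i. f ` (L \<inter> cball (c i) r)) (\<Union>i. f ` (L' \<inter> cball (c i) r))"
      using that x by (simp add: cover P_def)
    then obtain i j where
      "\<not> borel_separated (f ` (L \<inter> cball (c i) r)) (f ` (L' \<inter> cball (c j) r))"
      using borel_separated_UN[of "\<lambda>i. f ` (L \<inter> cball (c i) r)" "\<lambda>i. f ` (L' \<inter> cball (c i) r)"]
      by blast
    then have "P (L \<inter> cball (c i) r, L' \<inter> cball (c j) r)
        \<and> Q n x (L \<inter> cball (c i) r, L' \<inter> cball (c j) r)"
      using that x unfolding P_def Q_def r_def by (auto intro!: closed_Int)
    then show ?thesis by blast
  qed
  have "\<exists>g. \<forall>n. (P (g n) \<and> (n = 0 \<longrightarrow> g n = (K, K'))) \<and> Q n (g n) (g (Suc n))"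
    by (rule dependent_nat_choice) (use cl ns step in \<open>auto simp: P_def\<close>)
  then obtain g where g: "\<And>n. P (g n)" "g 0 = (K, K')" "\<And>n. Q n (g n) (g (Suc n))" by blast
  define L L' where "L n = fst (g n)" and "L' n = snd (g n)" for n
  have gn: "g n = (L n, L' n)" for n by (simp add: L_def L'_def)
  have LK: "L 0 = K" "L' 0 = K'" using g(2) by (auto simp: L_def L'_def)
  have closed: "closed (L n)" "closed (L' n)"
    and nsep: "\<not> borel_separated (f ` L n) (f ` L' n)" for n
    using g(1)[of n] by (auto simp: gn P_def)
  have ne: "L n \<noteq> {}" "L' n \<noteq> {}" for n
    using nsep[of n] by (auto simp: borel_separated_def)
  have next_ball: "\<exists>i j. L (Suc n) = L n \<inter> cball (c i) (inverse (Suc n))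
      \<and> L' (Suc n) = L' n \<inter> cball (c j) (inverse (Suc n))" for n
    using g(3)[of n] by (auto simp: gn Q_def)
  have dec: "L n \<subseteq> L m" "L' n \<subseteq> L' m" if "m \<le> n" for m n
    by (rule lift_Suc_antimono_le[OF _ that], use next_ball in blast)+
  have small: "\<exists>n. (\<forall>x\<in>L n. \<forall>y\<in>L n. dist x y < e) \<and> (\<forall>x\<in>L' n. \<forall>y\<in>L' n. dist x y < e)"
    if "e > 0" for e
  proof -
    obtain n where n: "inverse (real (Suc n)) < e / 2"
      using reals_Archimedean[of "e/2"] \<open>e > 0\<close> by auto
    have in_ball: "dist x y < e" if "x \<in> cball a (inverse (Suc n))" "y \<in> cball a (inverse (Suc n))"
      for x y a :: 'w
      using that n dist_triangle3[of x y a] by auto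
    show ?thesis using next_ball[of n] in_ball by (intro exI[of _ "Suc n"]) auto
  qed
  have small_L: "\<exists>n. \<forall>x\<in>L n. \<forall>y\<in>L n. dist x y < e" if "e > 0" for e
    using small[OF that] by meson
  have small_L': "\<exists>n. \<forall>x\<in>L' n. \<forall>y\<in>L' n. dist x y < e" if "e > 0" for e
    using small[OF that] by meson
  from decreasing_closed_nest_sing[OF closed(1) ne(1) dec(1) small_L]
  obtain a where a: "\<And>n. a \<in> L n" by auto
  from decreasing_closed_nest_sing[OF closed(2) ne(2) dec(2) small_L']
  obtain a' where a': "\<And>n. a' \<in> L' n" by auto
  have "f a \<noteq> f a'" using a[of 0] a'[of 0] LK disj by auto
  then obtain U V where UV: "open U" "open V" "f a \<in> U" "f a' \<in> V" "U \<inter> V = {}"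
    using hausdorff by metis
  have "open (f -` U)" "open (f -` V)"
    using UV f by (simp_all add: open_vimage)
  then obtain e e' where e: "e > 0" "ball a e \<subseteq> f -` U" "e' > 0" "ball a' e' \<subseteq> f -` V"
    using UV by (metis open_contains_ball vimageI)
  have "min e e' > 0" using e by simp
  from small[OF this] obtain n where n: "\<And>x y. x \<in> L n \<Longrightarrow> y \<in> L n \<Longrightarrow> dist x y < min e e'"
      "\<And>x y. x \<in> L' n \<Longrightarrow> y \<in> L' n \<Longrightarrow> dist x y < min e e'"
    by meson
  have "f ` L n \<subseteq> U" using n(1)[OF a] e(2) by fastforce
  moreover have "f ` L' n \<subseteq> V" using n(2)[OF a'] e(4) by fastforce
  ultimately have "borel_separated (f ` L n) (f ` L' n)"
    unfolding borel_separated_def using UV by (intro bexI[of _ U]) auto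
  then show False using nsep by blast
qed

text \<open>
  These are the analytic sets. The second factor replaces the Baire space; a sequence of naturals
  is recognised inside it because the naturals form a closed discrete set of reals.
\<close>

definition closed_projection :: "'z::topological_space set \<Rightarrow> bool" where
  "closed_projection A \<longleftrightarrow> (\<exists>K :: ('z \<times> (nat \<Rightarrow> real)) set. closed K \<and> A = fst ` K)"

lemma closed_projection_closed: "closed A \<Longrightarrow> closed_projection A"
  unfolding closed_projection_def
  by (rule exI[of _ "A \<times> UNIV"]) (auto intro: closed_Times)

text \<open>
  The coordinate \<open>0\<close> of the auxiliary sequence stores the index of the set to which the point
  belongs, and the remaining coordinates store a witness for that set.
\<close>

lemma closed_projection_UN:
  fixes A :: "nat \<Rightarrow> 'z::topological_space set"
  assumes "\<And>n. closed_projection (A n)"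
  shows "closed_projection (\<Union>n. A n)"
proof -
  obtain K :: "nat \<Rightarrow> ('z \<times> (nat \<Rightarrow> real)) set"
    where K: "\<And>n. closed (K n)" "\<And>n. A n = fst ` K n"
    using assms unfolding closed_projection_def by metis
  define s :: "'z \<times> (nat \<Rightarrow> real) \<Rightarrow> 'z \<times> (nat \<Rightarrow> real)"
    where "s p = (fst p, \<lambda>i. snd p (Suc i))" for p
  have coord: "continuous_on UNIV (\<lambda>p :: 'z \<times> (nat \<Rightarrow> real). snd p i)" for i
    by (rule continuous_on_product_then_coordinatewise) (intro continuous_intros)
  have s: "continuous_on UNIV s"
    unfolding s_def by (intro continuous_intros coord)
  define L where "L = (\<Inter>n. (\<lambda>p. snd p 0) -` (real ` (UNIV - {n})) \<union>
      ((\<lambda>p. snd p 0) -` {real n} \<inter> s -` K n))"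
  have "closed (real ` I)" for I
    by (rule closed_of_nat_image)
  then have "closed L"
    unfolding L_def using K(1) s coord
    by (intro closed_INT ballI closed_Un closed_Int closed_vimage) auto
  have L: "p \<in> L \<longleftrightarrow> (\<exists>n. snd p 0 = real n \<and> s p \<in> K n)" for p
  proof
    assume "p \<in> L"
    then have *: "(\<exists>m. m \<noteq> n \<and> snd p 0 = real m) \<or> (snd p 0 = real n \<and> s p \<in> K n)" for n
      unfolding L_def by blast
    then obtain N where "snd p 0 = real N" by metis
    then show "\<exists>n. snd p 0 = real n \<and> s p \<in> K n" using *[of N] by auto
  next
    assume "\<exists>n. snd p 0 = real n \<and> s p \<in> K n"
    then obtain N where "snd p 0 = real N" "s p \<in> K N" by blast
    then show "p \<in> L" unfolding L_def by auto
  qed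
  have "(\<Union>n. A n) = fst ` L"
  proof (intro equalityI subsetI)
    fix z assume "z \<in> (\<Union>n. A n)"
    then obtain n \<alpha> where "(z, \<alpha>) \<in> K n" using K(2) by auto
    then have "(z, case_nat (real n) \<alpha>) \<in> L" by (auto simp: L s_def)
    then show "z \<in> fst ` L" by force
  next
    fix z assume "z \<in> fst ` L"
    then obtain \<alpha> n where "s (z, \<alpha>) \<in> K n" using L by auto
    then have "z \<in> fst ` K n" by (force simp: s_def)
    then show "z \<in> (\<Union>n. A n)" using K(2) by auto
  qed
  then show ?thesis using \<open>closed L\<close> unfolding closed_projection_def by blast
qed

text \<open>
  One auxiliary sequence stores witnesses for all the sets at once, the \<open>n\<close>-th one in the
  coordinates \<open>prod_encode (n, i)\<close>.
\<close>

lemma closed_projection_INT: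
  fixes A :: "nat \<Rightarrow> 'z::topological_space set"
  assumes "\<And>n. closed_projection (A n)"
  shows "closed_projection (\<Inter>n. A n)"
proof -
  obtain K :: "nat \<Rightarrow> ('z \<times> (nat \<Rightarrow> real)) set"
    where K: "\<And>n. closed (K n)" "\<And>n. A n = fst ` K n"
    using assms unfolding closed_projection_def by metis
  define s :: "nat \<Rightarrow> 'z \<times> (nat \<Rightarrow> real) \<Rightarrow> 'z \<times> (nat \<Rightarrow> real)"
    where "s n p = (fst p, \<lambda>i. snd p (prod_encode (n, i)))" for n p
  have coord: "continuous_on UNIV (\<lambda>p :: 'z \<times> (nat \<Rightarrow> real). snd p i)" for i
    by (rule continuous_on_product_then_coordinatewise) (intro continuous_intros)
  have s: "continuous_on UNIV (s n)" for n
    unfolding s_def by (intro continuous_intros coord)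
  define L where "L = (\<Inter>n. s n -` K n)"
  have "closed L"
    unfolding L_def using K(1) s by (intro closed_INT ballI closed_vimage) auto
  have "(\<Inter>n. A n) = fst ` L"
  proof (intro equalityI subsetI)
    fix z assume "z \<in> (\<Inter>n. A n)"
    then have "\<forall>n. \<exists>\<alpha>. (z, \<alpha>) \<in> K n" using K(2) by fastforce
    then obtain \<alpha> where "\<And>n. (z, \<alpha> n) \<in> K n" by metis
    then have "(z, \<lambda>k. case prod_decode k of (n, i) \<Rightarrow> \<alpha> n i) \<in> L" by (auto simp: L_def s_def)
    then show "z \<in> fst ` L" by force
  next
    fix z assume "z \<in> fst ` L"
    then have "z \<in> fst ` K n" for n by (force simp: s_def L_def)
    then show "z \<in> (\<Inter>n. A n)" using K(2) by auto
  qed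
  then show ?thesis using \<open>closed L\<close> unfolding closed_projection_def by blast
qed

lemma open_UN_closed:
  fixes U :: "'z::metric_space set"
  assumes "open U"
  shows "\<exists>F :: nat \<Rightarrow> 'z set. (\<forall>n. closed (F n)) \<and> U = (\<Union>n. F n)"
proof (cases "U = UNIV")
  case True
  then show ?thesis by (intro exI[of _ "\<lambda>_. UNIV"]) simp
next
  case False
  then have ne: "- U \<noteq> {}" by auto
  have cl: "closed ((\<lambda>x. infdist x (- U)) -` {inverse (real (Suc n))..})" for n
    by (intro closed_vimage) (auto intro!: continuous_intros)
  have "U = (\<Union>n. (\<lambda>x. infdist x (- U)) -` {inverse (real (Suc n))..})"
  proof (intro equalityI subsetI)
    fix x assume "x \<in> U"
    then have "infdist x (- U) \<noteq> 0"
      using in_closed_iff_infdist_zero[of "- U" x] assms ne by auto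
    then have "infdist x (- U) > 0" using infdist_nonneg[of x "- U"] by linarith
    then obtain n where "inverse (real (Suc n)) < infdist x (- U)"
      using reals_Archimedean by blast
    then show "x \<in> (\<Union>n. (\<lambda>x. infdist x (- U)) -` {inverse (real (Suc n))..})"
      by (auto intro!: exI[of _ n])
  next
    fix x assume "x \<in> (\<Union>n. (\<lambda>x. infdist x (- U)) -` {inverse (real (Suc n))..})"
    then obtain n where "inverse (real (Suc n)) \<le> infdist x (- U)" by auto
    moreover have "inverse (real (Suc n)) > 0" by simp
    ultimately have "infdist x (- U) \<noteq> 0" by linarith
    then show "x \<in> U" using infdist_zero[of x "- U"] by blast
  qed
  with cl show ?thesis by (intro exI conjI allI)
qed

text \<open>
  The sets that are analytic together with their complement form a sigma-algebra. It contains the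
  open sets, which are countable unions of closed sets.
\<close>

lemma borel_closed_projection:
  fixes B :: "'z::metric_space set"
  assumes "B \<in> sets borel"
  shows "closed_projection B"
proof -
  have "B \<in> sigma_sets UNIV {S. open S}"
    using assms unfolding sets_borel .
  then have "closed_projection B \<and> closed_projection (- B)"
  proof induction
    case (Basic U)
    then have "open U" by simp
    from open_UN_closed[OF this]
    obtain F :: "nat \<Rightarrow> 'z set" where F: "(\<forall>n. closed (F n)) \<and> U = (\<Union>n. F n)" ..
    have "closed_projection (\<Union>n. F n)"
      by (intro closed_projection_UN closed_projection_closed) (use F in blast)
    then have "closed_projection U" using F by simp
    then show ?case using Basic closed_projection_closed[of "- U"] by auto
  next
    case Empty
    then show ?case by (simp add: closed_projection_closed)
  next
    case (Compl B)
    then show ?case by (metis Compl_eq_Diff_UNIV double_complement)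
  next
    case (Union B)
    then have "closed_projection (B n)" "closed_projection (- B n)" for n by simp_all
    then have "closed_projection (\<Union>n. B n)" "closed_projection (\<Inter>n. - B n)"
      by (auto intro: closed_projection_UN closed_projection_INT)
    then show ?case by (simp only: Compl_UN)
  qed
  then show ?thesis by blast
qed

lemma borel_images_separated:
  fixes B B' :: "'z::{complete_space,second_countable_topology} set"
    and f :: "'z \<Rightarrow> 'x::t2_space"
  assumes B: "B \<in> sets borel" "B' \<in> sets borel" and f: "continuous_on UNIV f"
    and disj: "f ` B \<inter> f ` B' = {}"
  shows "borel_separated (f ` B) (f ` B')"
proof -
  obtain K K' :: "('z \<times> (nat \<Rightarrow> real)) set"
    where K: "closed K" "B = fst ` K" "closed K'" "B' = fst ` K'"
    using borel_closed_projection B unfolding closed_projection_def by metis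
  have "borel_separated ((f \<circ> fst) ` K) ((f \<circ> fst) ` K')"
  proof (rule closed_images_separated)
    show "continuous_on UNIV (f \<circ> fst)"
      using f by (intro continuous_on_compose continuous_intros) (auto intro: continuous_on_subset)
    show "(f \<circ> fst) ` K \<inter> (f \<circ> fst) ` K' = {}"
      using disj unfolding K(2,4) image_comp .
  qed (fact K)+
  then show ?thesis unfolding K(2,4) image_comp .
qed

text \<open>
  The left inverse of \<open>f\<close> on \<open>f ` B\<close> extends to a Borel function \<open>l\<close>, whence \<open>f ` B\<close> is the
  Borel set of all \<open>x\<close> with \<open>l x \<in> B\<close> and \<open>f (l x) = x\<close>. To build \<open>l\<close>, separate for every small
  ball \<open>V i n\<close> the disjoint analytic sets \<open>f ` (B \<inter> V i n)\<close> and \<open>f ` (B - V i n)\<close> by a Borel set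
  \<open>C i n\<close>: then \<open>C i n\<close> tells, for points of \<open>f ` B\<close>, whether the preimage lies in \<open>V i n\<close>, and
  the centres of the first ball of each radius containing it converge to the preimage.
\<close>

theorem Lusin_Souslin:
  fixes B :: "'z::{complete_space,second_countable_topology} set"
    and f :: "'z \<Rightarrow> 'x::{t2_space,second_countable_topology}"
  assumes B: "B \<in> sets borel" and f: "continuous_on UNIV f" and inj: "inj_on f B"
  shows "f ` B \<in> sets borel"
proof -
  obtain c :: "nat \<Rightarrow> 'z" where c: "\<And>x e. e > 0 \<Longrightarrow> \<exists>i. dist x (c i) < e"
    using dense_sequence by blast
  define V where "V i n = ball (c i) (inverse (real (Suc n)))" for i n
  have "borel_separated (f ` (B \<inter> V i n)) (f ` (B - V i n))" for i n
    using B inj by (intro borel_images_separated f) (auto simp: V_def dest: inj_onD)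
  then have "\<forall>i n. \<exists>C\<in>sets borel. f ` (B \<inter> V i n) \<subseteq> C \<and> C \<inter> f ` (B - V i n) = {}"
    unfolding borel_separated_def by blast
  then obtain C where C: "\<And>i n. C i n \<in> sets borel"
      "\<And>i n. f ` (B \<inter> V i n) \<subseteq> C i n" "\<And>i n. C i n \<inter> f ` (B - V i n) = {}"
    by metis
  note [measurable] = C(1) B
  have [measurable]: "f \<in> borel_measurable borel"
    by (rule borel_measurable_continuous_onI[OF f])
  define g where "g n x = c (LEAST i. x \<in> C i n)" for n x
  have g_close: "dist z (g n (f z)) < inverse (Suc n)" if "z \<in> B" for z n
  proof -
    have "f z \<in> C i n \<longleftrightarrow> z \<in> V i n" for i
      using C(2,3)[of i n] that by blast
    then have iff: "f z \<in> C i n \<longleftrightarrow> z \<in> ball (c i) (inverse (Suc n))" for i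
      by (simp only: V_def)
    have "\<exists>i. f z \<in> C i n"
      using c[of "inverse (Suc n)" z] unfolding iff by (auto simp: dist_commute)
    then have "f z \<in> C (LEAST i. f z \<in> C i n) n" by (rule LeastI_ex)
    then show ?thesis unfolding iff g_def by (simp add: dist_commute)
  qed
  have g_lim: "(\<lambda>n. g n (f z)) \<longlonglongrightarrow> z" if "z \<in> B" for z
  proof (rule metric_LIMSEQ_I)
    fix r :: real assume "r > 0"
    then obtain N where N: "inverse (real (Suc N)) < r" using reals_Archimedean by blast
    have "dist (g n (f z)) z < r" if "n \<ge> N" for n
    proof -
      have "dist (g n (f z)) z < inverse (real (Suc n))"
        using g_close[OF \<open>z \<in> B\<close>, of n] by (simp only: dist_commute)
      also have "\<dots> \<le> inverse (real (Suc N))" using that by simp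
      also note N
      finally show ?thesis .
    qed
    then show "\<exists>N. \<forall>n\<ge>N. dist (g n (f z)) z < r" by blast
  qed
  have [measurable]: "g n \<in> borel_measurable borel" for n
  proof -
    have "(\<lambda>x. LEAST i. x \<in> C i n) \<in> borel \<rightarrow>\<^sub>M count_space UNIV"
      by measurable
    then show ?thesis
      unfolding g_def by (rule measurable_compose) simp
  qed
  (* outside f ` B the approximations need not converge; they are replaced by a constant there *)
  define h where "h n x = (if Cauchy (\<lambda>n. g n x) then g n x else c 0)" for n x
  define l where "l x = lim (\<lambda>n. h n x)" for x
  have [measurable]: "h n \<in> borel_measurable borel" for n
    unfolding h_def by measurable
  have h_lim: "(\<lambda>n. h n x) \<longlonglongrightarrow> l x" for x
  proof -
    have "convergent (\<lambda>n. h n x)"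
      by (cases "Cauchy (\<lambda>n. g n x)") (auto simp: h_def Cauchy_convergent convergent_const)
    then show ?thesis unfolding l_def by (simp add: convergent_LIMSEQ_iff)
  qed
  have [measurable]: "l \<in> borel_measurable borel"
    by (rule borel_measurable_LIMSEQ_metric[OF _ h_lim]) measurable
  have l: "l (f z) = z" if "z \<in> B" for z
  proof (rule LIMSEQ_unique[OF h_lim])
    have "Cauchy (\<lambda>n. g n (f z))" using g_lim[OF that] by (rule LIMSEQ_imp_Cauchy)
    then show "(\<lambda>n. h n (f z)) \<longlonglongrightarrow> z" using g_lim[OF that] by (simp add: h_def)
  qed
  have "f ` B = {x. l x \<in> B \<and> f (l x) = x}"
    using l by (auto intro!: image_eqI)
  also have "\<dots> = {x \<in> space borel. l x \<in> B \<and> f (l x) = x}" by simp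
  also have "\<dots> \<in> sets borel" by measurable
  finally show ?thesis .
qed


section \<open>Bounded-to-one Borel images\<close>

text \<open>
  Induction on the bound. The points \<open>P\<close> whose fibre has the maximal size \<open>k + 1\<close> form a Borel set:
  the members of such a fibre lie in \<open>k + 1\<close> pairwise disjoint balls from a countable family, and
  once these balls are fixed, the tuple listing the fibre along the balls is determined by the
  point, so that \<open>Lusin_Souslin\<close> applies in the space of tuples. The fibres over the complement of
  \<open>P\<close> have at most \<open>k\<close> elements.
\<close>

theorem borel_image_bounded_to_one:
  fixes B :: "'z::{complete_space,second_countable_topology} set"
    and f :: "'z \<Rightarrow> 'x::{t2_space,second_countable_topology}"
  assumes "B \<in> sets borel" and f: "continuous_on UNIV f"
    and "\<And>x. finite {z \<in> B. f z = x} \<and> card {z \<in> B. f z = x} \<le> k"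
  shows "f ` B \<in> sets borel"
  using assms(1,3)
proof (induction k arbitrary: B)
  case 0
  then have "{z \<in> B. f z = x} = {}" for x by (metis card_eq_0_iff le_zero_eq)
  then have "B = {}" by blast
  then show ?case by simp
next
  case (Suc k)
  note [measurable] = Suc.prems(1)
  have fm [measurable]: "f \<in> borel_measurable borel"
    by (rule borel_measurable_continuous_onI[OF f])
  have coord [measurable]: "(\<lambda>t :: nat \<Rightarrow> 'z. t i) \<in> borel_measurable borel" for i
    by (rule borel_measurable_continuous_onI) simp
  obtain c :: "nat \<Rightarrow> 'z" where c: "\<And>x e. e > 0 \<Longrightarrow> \<exists>i. dist x (c i) < e"
    using dense_sequence by blast
  define V where "V \<sigma> n i = ball (c (\<sigma> ! i)) (inverse (real (Suc n)))" for \<sigma> :: "nat list" and n i :: nat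
  define good where "good = {(\<sigma>, n). \<forall>i\<le>k. \<forall>j\<le>k. i \<noteq> j \<longrightarrow> V \<sigma> n i \<inter> V \<sigma> n j = {}}"
  define S where "S \<sigma> n = {t. (\<forall>i\<le>k. t i \<in> B \<and> t i \<in> V \<sigma> n i \<and> f (t i) = f (t 0))
      \<and> (\<forall>i\<in>{Suc k..}. t i = t 0)}" for \<sigma> n
  define P where "P = (\<Union>(\<sigma>, n)\<in>good. (\<lambda>t. f (t 0)) ` S \<sigma> n)"
  have inj: "inj_on (\<lambda>t. f (t 0)) (S \<sigma> n)" if "(\<sigma>, n) \<in> good" for \<sigma> n
  proof (rule inj_onI)
    fix s t assume st: "s \<in> S \<sigma> n" "t \<in> S \<sigma> n" "f (s 0) = f (t 0)"
    let ?F = "{z \<in> B. f z = f (t 0)}"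
    have disj: "i = j" if "z \<in> V \<sigma> n i" "z \<in> V \<sigma> n j" "i \<le> k" "j \<le> k" for i j z
      using \<open>(\<sigma>, n) \<in> good\<close> that unfolding good_def by blast
    have in_S: "t' i \<in> V \<sigma> n i" "t' i \<in> B" "f (t' i) = f (t' 0)" if "t' \<in> S \<sigma> n" "i \<le> k" for t' i
      using that unfolding S_def by blast+
    have tV: "t i \<in> V \<sigma> n i" "s i \<in> V \<sigma> n i" "s i \<in> ?F" "t i \<in> ?F" if "i \<le> k" for i
      using in_S[OF st(1) that] in_S[OF st(2) that] st(3) by simp_all
    have "inj_on t {..k}"
      using disj tV(1) by (intro inj_onI) (metis atMost_iff)
    then have "card (t ` {..k}) = Suc k" by (simp add: card_image)
    moreover have "t ` {..k} \<subseteq> ?F" using tV by blast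
    ultimately have F: "?F = t ` {..k}"
      using Suc.prems(2)[of "f (t 0)"] by (metis card_seteq)
    have eq: "s i = t i" if i: "i \<le> k" for i
    proof -
      obtain j where "j \<le> k" "s i = t j" using tV(3)[OF i] unfolding F by blast
      then show ?thesis using disj[of "s i" i j] tV(2)[OF i] tV(1)[of j] i by simp
    qed
    show "s = t"
    proof
      fix i
      show "s i = t i"
      proof (cases "i \<le> k")
        case False
        then have "i \<in> {Suc k..}" by simp
        then have "s i = s 0" "t i = t 0" using st(1,2) unfolding S_def by blast+
        then show ?thesis using eq[of 0] by simp
      qed (rule eq)
    qed
  qed
  have S: "S \<sigma> n \<in> sets borel" for \<sigma> n
  proof -
    define A where "A i = ((\<lambda>t. t i) -` (B \<inter> V \<sigma> n i) \<inter> space borel) \<inter> {t. f (t i) = f (t 0)}" for i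
    define E where "E i = {t :: nat \<Rightarrow> 'z. t i = t 0}" for i
    have ft: "continuous_on UNIV (\<lambda>t :: nat \<Rightarrow> 'z. f (t i))" for i
      by (rule continuous_on_compose2[OF f]) auto
    have "B \<inter> V \<sigma> n i \<in> sets borel" for i
      using Suc.prems(1) by (simp add: V_def)
    then have "A i \<in> sets borel" for i
      unfolding A_def using ft
      by (intro sets.Int[OF measurable_sets[OF coord] borel_closed] closed_Collect_eq)
    moreover have "E i \<in> sets borel" for i
      unfolding E_def by (intro borel_closed closed_Collect_eq) simp_all
    moreover have "S \<sigma> n = (\<Inter>i\<in>{..k}. A i) \<inter> (\<Inter>i\<in>{Suc k..}. E i)"
      unfolding S_def A_def E_def by auto
    moreover have "{..k} \<noteq> {}" "{Suc k..} \<noteq> {}" by auto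
    ultimately show ?thesis
      by (auto intro!: sets.Int sets.countable_INT'')
  qed
  have P: "P \<in> sets borel"
  proof -
    have "(\<lambda>t. f (t 0)) ` S \<sigma> n \<in> sets borel" if "(\<sigma>, n) \<in> good" for \<sigma> n
      by (rule Lusin_Souslin[OF S _ inj[OF that]]) (rule continuous_on_compose2[OF f], auto)
    then show ?thesis
      unfolding P_def by (intro sets.countable_UN'') (auto intro: countableI_type)
  qed
  have full: "x \<in> P" if card: "card {z \<in> B. f z = x} = Suc k" for x
  proof -
    let ?F = "{z \<in> B. f z = x}"
    have "finite ?F" using Suc.prems(2) by blast
    then obtain h where h: "bij_betw h {0..<Suc k} ?F"
      using ex_bij_betw_nat_finite card by metis
    have hF: "h i \<in> B" "f (h i) = x" if "i \<le> k" for i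
      using bij_betwE[OF h] that by auto
    (* the members of the fibre have mutual distance at least \<delta>, so balls of radius below \<delta> / 4
       containing different members are disjoint *)
    define \<delta> where "\<delta> = Min (insert 1 ((\<lambda>(y, z). dist y z) ` {p \<in> ?F \<times> ?F. fst p \<noteq> snd p}))"
    have fin: "finite (insert 1 ((\<lambda>(y, z). dist y z) ` {p \<in> ?F \<times> ?F. fst p \<noteq> snd p}))"
      using \<open>finite ?F\<close> by (intro finite.insertI finite_imageI finite_subset[OF _ finite_cartesian_product]) auto
    have "\<delta> > 0" unfolding \<delta>_def using fin by (subst Min_gr_iff) auto
    have \<delta>: "\<delta> \<le> dist y z" if "y \<in> ?F" "z \<in> ?F" "y \<noteq> z" for y z
      unfolding \<delta>_def using fin that by (intro Min_le) force+
    obtain n where n: "inverse (real (Suc n)) < \<delta> / 4"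
      using reals_Archimedean[of "\<delta> / 4"] \<open>\<delta> > 0\<close> by auto
    have "\<forall>i. \<exists>m. dist (h i) (c m) < inverse (real (Suc n))" using c by simp
    then obtain s where s: "\<And>i. dist (h i) (c (s i)) < inverse (real (Suc n))" by metis
    define \<sigma> where "\<sigma> = map s [0..<Suc k]"
    have V: "V \<sigma> n i = ball (c (s i)) (inverse (real (Suc n)))" if "i \<le> k" for i
      using that unfolding V_def \<sigma>_def by (simp del: upt_Suc)
    have "(\<sigma>, n) \<in> good"
      unfolding good_def
    proof (clarify, rule ccontr)
      fix i j assume ij: "i \<le> k" "j \<le> k" "i \<noteq> j" and "V \<sigma> n i \<inter> V \<sigma> n j \<noteq> {}"
      then obtain y where "dist (c (s i)) y < inverse (real (Suc n))"
          "dist (c (s j)) y < inverse (real (Suc n))"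
        by (auto simp: V simp del: of_nat_Suc)
      then have "dist (h i) (h j) < \<delta>"
        using s[of i] s[of j] n dist_triangle[of "h i" "h j" "c (s i)"]
          dist_triangle[of "c (s i)" "h j" y] dist_triangle[of y "h j" "c (s j)"]
        by (simp add: dist_commute del: of_nat_Suc)
      moreover have "h i \<noteq> h j"
        using h ij unfolding bij_betw_def inj_on_def by auto
      ultimately show False using \<delta>[of "h i" "h j"] hF ij by auto
    qed
    moreover have "(\<lambda>i. if i \<le> k then h i else h 0) \<in> S \<sigma> n"
      unfolding S_def using hF s by (auto simp: V dist_commute simp del: of_nat_Suc)
    ultimately have "f ((\<lambda>i. if i \<le> k then h i else h 0) 0) \<in> P"
      unfolding P_def by fast
    then show ?thesis using hF by simp
  qed
  define B' where "B' = B - f -` P"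
  have B'm: "B' \<in> sets borel"
  proof -
    have "f -` P \<inter> space borel \<in> sets borel" using P by measurable
    then show ?thesis unfolding B'_def using Suc.prems(1) by auto
  qed
  have "finite {z \<in> B'. f z = x} \<and> card {z \<in> B'. f z = x} \<le> k" for x
  proof (cases "x \<in> P")
    case True
    then have "{z \<in> B'. f z = x} = {}" unfolding B'_def by blast
    then show ?thesis by (simp only: finite.emptyI card.empty le0 simp_thms)
  next
    case False
    then have "{z \<in> B'. f z = x} = {z \<in> B. f z = x}" unfolding B'_def by blast
    then show ?thesis using full[of x] False Suc.prems(2)[of x] by (metis le_SucE)
  qed
  then have "f ` B' \<in> sets borel" using Suc.IH B'm by blast
  moreover have "P \<subseteq> f ` B"
  proof -
    have "t 0 \<in> B" if "t \<in> S \<sigma> n" for t \<sigma> n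
      using that le0[of k] unfolding S_def by blast
    then show ?thesis unfolding P_def by blast
  qed
  then have "f ` B = P \<union> f ` B'" unfolding B'_def by blast
  ultimately show ?case using P by simp
qed

text \<open>
  For a complete metric and a dense sequence \<open>a\<close>, send \<open>x\<close> to its distances from all \<open>a i\<close>. In the
  closure of the range, a sequence belongs to the range iff its infimum is \<open>0\<close>, since approximating
  points are then Cauchy; hence the range is Borel. Balls around the \<open>a i\<close> are mapped to
  traces of half-spaces on the range, so open sets and then all Borel sets have Borel images.
\<close>

lemma standard_borel_embedding:
  assumes "standard_borel M"
  obtains \<phi> :: "'a \<Rightarrow> nat \<Rightarrow> real" where
    "\<phi> \<in> M \<rightarrow>\<^sub>M borel" "inj_on \<phi> (space M)" "\<And>A. A \<in> sets M \<Longrightarrow> \<phi> ` A \<in> sets borel"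
proof (cases "space M = {}")
  case True
  have [dest]: "A = {}" if "A \<in> sets M" for A using sets.sets_into_space[OF that] True by simp
  show thesis
    by (intro that[of "\<lambda>_ _. 0"]) (auto simp: measurable_def True)
next
  case False
  obtain T where T: "topspace T = space M" "completely_metrizable_space T" "separable_space T"
    "sets M = sigma_sets (space M) {U. openin T U}"
    using assms unfolding standard_borel_def by blast
  obtain X d where "Metric_space X d" and mc: "Metric_space.mcomplete X d"
    and TX: "T = Metric_space.mtopology X d"
    using T(2) unfolding completely_metrizable_space_def by blast
  interpret Metric_space X d by fact
  have X: "X = space M" using T(1) TX by simp
  obtain D where D: "countable D" "D \<subseteq> X" "mtopology closure_of D = X"
    using T(3) unfolding separable_space_def TX by (auto simp: topspace_mtopology)
  have "D \<noteq> {}" using D(3) False X by auto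
  define a where "a = from_nat_into D"
  have aX: "a i \<in> X" for i
    unfolding a_def using from_nat_into[OF \<open>D \<noteq> {}\<close>] D(2) by blast
  have dense: "\<exists>i. d (a i) x < e" if "x \<in> X" "e > 0" for x e
  proof -
    have "x \<in> {x \<in> X. \<forall>r>0. \<exists>y\<in>D. y \<in> mball x r}"
      using D(3) \<open>x \<in> X\<close> unfolding metric_closure_of by simp
    then obtain y where "y \<in> D" "y \<in> mball x e" using \<open>e > 0\<close> by blast
    moreover then obtain i where "a i = y"
      using from_nat_into_surj[OF D(1)] unfolding a_def by blast
    ultimately show ?thesis using commute by auto
  qed
  define \<phi> :: "'a \<Rightarrow> nat \<Rightarrow> real" where "\<phi> x i = d (a i) x" for x i
  have openM: "U \<in> sets M" if "openin mtopology U" for U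
    using that T(4) TX by auto
  have coord [measurable]: "(\<lambda>s :: nat \<Rightarrow> real. s i) \<in> borel_measurable borel" for i
    by (rule borel_measurable_continuous_onI) simp
  have meas: "\<phi> \<in> M \<rightarrow>\<^sub>M borel"
  proof (rule measurable_coordinatewise_then_product)
    fix i
    have "{x \<in> space M. \<phi> x i < r} = mball (a i) r" for r
      using aX by (auto simp: \<phi>_def X[symmetric])
    then show "(\<lambda>x. \<phi> x i) \<in> borel_measurable M"
      using openM by (simp add: borel_measurable_iff_less)
  qed
  have le_\<phi>: "d x y \<le> \<phi> x i + \<phi> y i" if "x \<in> X" "y \<in> X" for x y i
    using triangle[of x "a i" y] that aX commute unfolding \<phi>_def by simp
  have inj: "inj_on \<phi> (space M)"
  proof (rule inj_onI)
    fix x y assume xy: "x \<in> space M" "y \<in> space M" and eq: "\<phi> x = \<phi> y"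
    have "d x y < e" if "e > 0" for e
    proof -
      obtain i where "\<phi> x i < e / 2"
        using dense[of x "e/2"] xy X \<open>e > 0\<close> unfolding \<phi>_def by auto
      then show ?thesis using le_\<phi>[of x y i] eq xy X by simp
    qed
    then have "d x y \<le> 0" by (meson less_irrefl not_le)
    then have "d x y = 0" using nonneg[of x y] by simp
    then show "x = y" using zero[of x y] xy X by simp
  qed
  have range: "\<phi> ` X = closure (\<phi> ` X) \<inter> {s. \<forall>k. \<exists>i. s i < inverse (real (Suc k))}"
  proof (intro equalityI subsetI)
    fix s assume s: "s \<in> \<phi> ` X"
    then obtain x where "x \<in> X" "s = \<phi> x" by blast
    then have "\<exists>i. s i < inverse (real (Suc k))" for k
      using dense[of x "inverse (real (Suc k))"] by (simp add: \<phi>_def)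
    then show "s \<in> closure (\<phi> ` X) \<inter> {s. \<forall>k. \<exists>i. s i < inverse (real (Suc k))}"
      using s closure_subset[of "\<phi> ` X"] by blast
  next
    fix s assume s: "s \<in> closure (\<phi> ` X) \<inter> {s. \<forall>k. \<exists>i. s i < inverse (real (Suc k))}"
    then have "s \<in> closure (\<phi> ` X)" by (rule IntD1)
    then have "\<exists>u. (\<forall>n. u n \<in> \<phi> ` X) \<and> u \<longlonglongrightarrow> s"
      by (simp only: closure_sequential)
    then obtain u where u: "\<forall>n. u n \<in> \<phi> ` X" "u \<longlonglongrightarrow> s" by meson
    then have "\<forall>n. \<exists>y. y \<in> X \<and> u n = \<phi> y" by blast
    then obtain x where x: "\<And>n. x n \<in> X" "\<And>n. u n = \<phi> (x n)" by metis
    have lim: "(\<lambda>n. \<phi> (x n) i) \<longlonglongrightarrow> s i" for i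
    proof -
      have "continuous_on UNIV (\<lambda>s :: nat \<Rightarrow> real. s i)" by simp
      then have "isCont (\<lambda>s :: nat \<Rightarrow> real. s i) s"
        unfolding continuous_on_eq_continuous_at[OF open_UNIV] by blast
      then have "(\<lambda>n. u n i) \<longlonglongrightarrow> s i" using u(2) by (rule isCont_tendsto_compose)
      then show ?thesis by (simp add: x)
    qed
    have "MCauchy x"
      unfolding MCauchy_def
    proof (intro conjI allI impI)
      show "range x \<subseteq> X" using x by blast
      fix e :: real assume "e > 0"
      then obtain k where "inverse (real (Suc k)) < e / 2"
        using reals_Archimedean[of "e/2"] by (metis half_gt_zero)
      moreover obtain i where "s i < inverse (real (Suc k))" using s by blast
      ultimately have "s i < e / 2" by simp
      then have "\<forall>\<^sub>F n in sequentially. \<phi> (x n) i < e / 2"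
        by (rule order_tendstoD(2)[OF lim])
      then obtain N where N: "\<And>n. n \<ge> N \<Longrightarrow> \<phi> (x n) i < e / 2"
        unfolding eventually_sequentially by blast
      have "d (x n) (x n') < e" if "N \<le> n" "N \<le> n'" for n n'
        using le_\<phi>[OF x(1)[of n] x(1)[of n'], of i] N[OF that(1)] N[OF that(2)] by simp
      then show "\<exists>N. \<forall>n n'. N \<le> n \<longrightarrow> N \<le> n' \<longrightarrow> d (x n) (x n') < e" by blast
    qed
    then obtain l where l: "limitin mtopology x l sequentially"
      using mc unfolding mcomplete_def by blast
    then have "l \<in> X" and dl: "(\<lambda>n. d (x n) l) \<longlonglongrightarrow> 0"
      by (auto simp: limitin_metric_dist_null)
    have "\<phi> l i = s i" for i
    proof (rule LIMSEQ_unique[OF _ lim])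
      have "\<bar>\<phi> (x n) i - \<phi> l i\<bar> \<le> d (x n) l" for n
        using triangle[of "a i" "x n" l] triangle[of "a i" l "x n"] commute[of l "x n"]
          aX[of i] x(1)[of n] \<open>l \<in> X\<close>
        unfolding \<phi>_def by linarith
      then show "(\<lambda>n. \<phi> (x n) i) \<longlonglongrightarrow> \<phi> l i"
        by (intro LIM_zero_cancel[OF tendsto_rabs_zero_cancel[OF tendsto_sandwich[OF _ _ tendsto_const dl]]]) auto
    qed
    then have "s = \<phi> l" by (simp add: fun_eq_iff)
    then show "s \<in> \<phi> ` X" using \<open>l \<in> X\<close> by (rule image_eqI)
  qed
  have rangem: "\<phi> ` X \<in> sets borel"
  proof -
    have "{s :: nat \<Rightarrow> real \<in> space borel. \<forall>k. \<exists>i. s i < inverse (real (Suc k))} \<in> sets borel"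
      by measurable
    then show ?thesis by (subst range) simp
  qed
  have "\<phi> ` A \<in> sets borel" if "A \<in> sets M" for A
  proof -
    have "A \<in> sigma_sets (space M) {U. openin mtopology U}" using that T(4) TX by simp
    then show ?thesis
    proof induction
      case (Basic U)
      then have U: "openin mtopology U" by simp
      then have UX: "U \<subseteq> X" by (simp add: openin_mtopology)
      define I where "I = {(i, k). mball (a i) (inverse (real (Suc k))) \<subseteq> U}"
      have "\<phi> ` U = \<phi> ` X \<inter> (\<Union>(i, k)\<in>I. {s. s i < inverse (real (Suc k))})"
      proof (intro equalityI subsetI)
        fix s assume "s \<in> \<phi> ` U"
        then obtain x where x: "x \<in> U" "s = \<phi> x" by blast
        then obtain r where r: "r > 0" "mball x r \<subseteq> U" using U unfolding openin_mtopology by blast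
        obtain k where k: "inverse (real (Suc k)) < r / 2" using reals_Archimedean[of "r/2"] r by auto
        obtain i where i: "d (a i) x < inverse (real (Suc k))"
          using dense[of x "inverse (real (Suc k))"] x UX by auto
        have "mball (a i) (inverse (real (Suc k))) \<subseteq> mball x r"
        proof
          fix y assume "y \<in> mball (a i) (inverse (real (Suc k)))"
          then have "d (a i) y < inverse (real (Suc k))" "y \<in> X" by auto
          moreover have "x \<in> X" using x UX by blast
          ultimately show "y \<in> mball x r"
            using triangle[of x "a i" y] aX[of i] i k commute[of x "a i"] by simp
        qed
        then have "(i, k) \<in> I" using r unfolding I_def by blast
        moreover have "s i < inverse (real (Suc k))" using i x by (simp add: \<phi>_def)
        ultimately show "s \<in> \<phi> ` X \<inter> (\<Union>(i, k)\<in>I. {s. s i < inverse (real (Suc k))})"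
          using x UX by blast
      next
        fix s assume "s \<in> \<phi> ` X \<inter> (\<Union>(i, k)\<in>I. {s. s i < inverse (real (Suc k))})"
        then obtain x i k where "x \<in> X" "s = \<phi> x" "(i, k) \<in> I" "s i < inverse (real (Suc k))" by blast
        then show "s \<in> \<phi> ` U" using aX[of i] unfolding I_def \<phi>_def by auto
      qed
      moreover have "{s :: nat \<Rightarrow> real \<in> space borel. s i < inverse (real (Suc k))} \<in> sets borel" for i k
        by measurable
      then have "(\<Union>(i, k)\<in>I. {s :: nat \<Rightarrow> real. s i < inverse (real (Suc k))}) \<in> sets borel"
        by (intro sets.countable_UN') auto
      ultimately show ?case using rangem by auto
    next
      case Empty
      show ?case by simp
    next
      case (Compl A)
      then have "A \<subseteq> space M" using T(4) TX sets.sets_into_space by metis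
      then have "\<phi> ` (space M - A) = \<phi> ` X - \<phi> ` A"
        using inj by (subst inj_on_image_set_diff[of \<phi> "space M"]) (auto simp: X)
      then show ?case using rangem Compl.IH by auto
    next
      case (Union A)
      then show ?case unfolding image_UN by blast
    qed
  qed
  with meas inj show thesis by (rule that)
qed


text \<open>
  The embedding turns tuples over \<open>M\<close> into points of a function space over a complete metric space,
  padded by a constant beyond \<open>n\<close> so that tuples correspond to single points; there the coordinate
  map is continuous and \<open>borel_image_bounded_to_one\<close> applies.
\<close>

theorem standard_borel_coordinate_image:
  fixes n a k :: nat
  assumes M: "standard_borel M" and R: "R \<in> sets (PiM {..<n} (\<lambda>_. M))" and "a < n"
    and bound: "\<And>x. finite {t \<in> R. t a = x} \<and> card {t \<in> R. t a = x} \<le> k"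
  shows "(\<lambda>t. t a) ` R \<in> sets M"
proof -
  obtain \<phi> :: "'a \<Rightarrow> nat \<Rightarrow> real" where \<phi>: "\<phi> \<in> M \<rightarrow>\<^sub>M borel" "inj_on \<phi> (space M)"
      "\<And>A. A \<in> sets M \<Longrightarrow> \<phi> ` A \<in> sets borel"
    by (rule standard_borel_embedding[OF M]) blast
  have RX: "t i \<in> space M" if "t \<in> R" "i < n" for t i
    using sets.sets_into_space[OF R] that by (auto simp: space_PiM)
  have Rext: "t \<in> extensional {..<n}" if "t \<in> R" for t
    using sets.sets_into_space[OF R] that by (auto simp: space_PiM PiE_iff)
  define \<psi> where "\<psi> = the_inv_into (space M) \<phi>"
  have \<psi>: "\<psi> (\<phi> x) = x" if "x \<in> space M" for x
    unfolding \<psi>_def using \<phi>(2) that by (rule the_inv_into_f_f)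
  define \<Phi> :: "(nat \<Rightarrow> 'a) \<Rightarrow> nat \<Rightarrow> nat \<Rightarrow> real"
    where "\<Phi> t i = (if i < n then \<phi> (t i) else (\<lambda>_. 0))" for t i
  define \<Psi> where "\<Psi> s = (\<lambda>i\<in>{..<n}. \<psi> (s i))" for s :: "nat \<Rightarrow> nat \<Rightarrow> real"
  define Y where "Y = (\<Inter>i\<in>{..<n}. (\<lambda>s. s i) -` (\<phi> ` space M) \<inter> space borel)
    \<inter> (\<Inter>i\<in>{n..}. {s :: nat \<Rightarrow> nat \<Rightarrow> real. s i = (\<lambda>_. 0)})"
  have \<Psi>\<Phi>: "\<Psi> (\<Phi> t) = t" if "t \<in> R" for t
    using RX[OF that] Rext[OF that] by (auto simp: \<Psi>_def \<Phi>_def \<psi> extensional_def)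
  have \<Phi>\<Psi>: "\<Phi> (\<Psi> s) = s" if "s \<in> Y" for s
  proof
    fix i
    show "\<Phi> (\<Psi> s) i = s i"
    proof (cases "i < n")
      case True
      then have "s i \<in> \<phi> ` space M" using that unfolding Y_def by blast
      then show ?thesis using True \<psi> by (auto simp: \<Phi>_def \<Psi>_def)
    next
      case False
      then have "i \<in> {n..}" by simp
      then have "s i = (\<lambda>_. 0)" using that unfolding Y_def by blast
      then show ?thesis using False by (simp add: \<Phi>_def)
    qed
  qed
  have coord: "(\<lambda>s :: nat \<Rightarrow> nat \<Rightarrow> real. s i) \<in> borel_measurable borel" for i
    by (rule borel_measurable_continuous_onI) simp
  have Y: "Y \<in> sets borel"
  proof -
    have "(\<lambda>s :: nat \<Rightarrow> nat \<Rightarrow> real. s i) -` (\<phi> ` space M) \<inter> space borel \<in> sets borel" for i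
      by (rule measurable_sets[OF coord \<phi>(3)]) simp
    moreover have "{s :: nat \<Rightarrow> nat \<Rightarrow> real. s i = (\<lambda>_. 0)} \<in> sets borel" for i
      by (intro borel_closed closed_Collect_eq) simp_all
    ultimately show ?thesis
      unfolding Y_def by (intro sets.Int sets.countable_INT'') auto
  qed
  have \<psi>m: "\<psi> \<in> restrict_space borel (\<phi> ` space M) \<rightarrow>\<^sub>M M"
  proof (rule measurableI)
    show "\<psi> s \<in> space M" if "s \<in> space (restrict_space borel (\<phi> ` space M))" for s
      using that \<psi> by (auto simp: space_restrict_space)
    fix A assume A: "A \<in> sets M"
    then have "A \<subseteq> space M" by (rule sets.sets_into_space)
    then have "\<psi> -` A \<inter> space (restrict_space borel (\<phi> ` space M)) = \<phi> ` A"
      using \<psi> by (auto simp: space_restrict_space)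
    then show "\<psi> -` A \<inter> space (restrict_space borel (\<phi> ` space M))
        \<in> sets (restrict_space borel (\<phi> ` space M))"
      using \<phi>(3)[OF A] \<phi>(3)[OF sets.top] \<open>A \<subseteq> space M\<close> by (auto simp: sets_restrict_space_iff)
  qed
  have \<Psi>m: "\<Psi> \<in> restrict_space borel Y \<rightarrow>\<^sub>M PiM {..<n} (\<lambda>_. M)"
    unfolding \<Psi>_def
  proof (rule measurable_restrict)
    fix i assume "i \<in> {..<n}"
    have "(\<lambda>s. s i) \<in> restrict_space borel Y \<rightarrow>\<^sub>M restrict_space borel (\<phi> ` space M)"
    proof (rule measurable_restrict_space2)
      show "(\<lambda>s. s i) \<in> space (restrict_space borel Y) \<rightarrow> \<phi> ` space M"
        using \<open>i \<in> {..<n}\<close> by (auto simp: space_restrict_space Y_def)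
    qed (rule measurable_restrict_space1[OF coord])
    then show "(\<lambda>s. \<psi> (s i)) \<in> restrict_space borel Y \<rightarrow>\<^sub>M M"
      by (rule measurable_compose[OF _ \<psi>m])
  qed
  have \<Phi>Y: "\<Phi> t \<in> Y" if "t \<in> R" for t
    using RX[OF that] by (auto simp: Y_def \<Phi>_def)
  have image: "\<Phi> ` R = \<Psi> -` R \<inter> space (restrict_space borel Y)"
    using \<Psi>\<Phi> \<Phi>\<Psi> \<Phi>Y by (force simp: space_restrict_space image_iff)
  have "\<Phi> ` R \<in> sets (restrict_space borel Y)"
    unfolding image by (rule measurable_sets[OF \<Psi>m R])
  then have \<Phi>R: "\<Phi> ` R \<in> sets borel"
    using Y by (simp add: sets_restrict_space_iff)
  have "(\<lambda>s. s a) ` \<Phi> ` R \<in> sets borel"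
  proof (rule borel_image_bounded_to_one[OF \<Phi>R continuous_on_product_coordinates])
    fix y
    show "finite {s \<in> \<Phi> ` R. s a = y} \<and> card {s \<in> \<Phi> ` R. s a = y} \<le> k"
    proof -
      have "{s \<in> \<Phi> ` R. s a = y} \<subseteq> \<Phi> ` {t \<in> R. t a = \<psi> y}"
        using \<psi> RX \<open>a < n\<close> by (auto simp: \<Phi>_def)
      moreover have "finite (\<Phi> ` {t \<in> R. t a = \<psi> y})" "card (\<Phi> ` {t \<in> R. t a = \<psi> y}) \<le> k"
        using bound[of "\<psi> y"] card_image_le[of "{t \<in> R. t a = \<psi> y}" \<Phi>] by auto
      ultimately show ?thesis by (meson card_mono finite_subset le_trans)
    qed
  qed
  then have "\<phi> -` ((\<lambda>s. s a) ` \<Phi> ` R) \<inter> space M \<in> sets M"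
    by (rule measurable_sets[OF \<phi>(1)])
  moreover have "(\<lambda>t. t a) ` R = \<phi> -` ((\<lambda>s. s a) ` \<Phi> ` R) \<inter> space M"
  proof (intro equalityI subsetI)
    fix x assume "x \<in> (\<lambda>t. t a) ` R"
    then obtain t where t: "t \<in> R" "x = t a" by blast
    then have "\<phi> x = \<Phi> t a" using \<open>a < n\<close> by (simp add: \<Phi>_def)
    then show "x \<in> \<phi> -` ((\<lambda>s. s a) ` \<Phi> ` R) \<inter> space M"
      using t RX[OF t(1) \<open>a < n\<close>] by blast
  next
    fix x assume x: "x \<in> \<phi> -` ((\<lambda>s. s a) ` \<Phi> ` R) \<inter> space M"
    then obtain t where t: "t \<in> R" "\<phi> x = \<Phi> t a" by blast
    then have "\<phi> x = \<phi> (t a)" using \<open>a < n\<close> by (simp add: \<Phi>_def)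
    then have "x = t a" using x RX[OF t(1) \<open>a < n\<close>] \<phi>(2) by (auto dest: inj_onD)
    then show "x \<in> (\<lambda>t. t a) ` R" using t(1) by blast
  qed
  ultimately show ?thesis by simp
qed


section \<open>The symmetric local lemma for uniform colourings\<close>

abbreviation colourings :: "nat \<Rightarrow> 'a set \<Rightarrow> ('a \<Rightarrow> nat) set" where
  "colourings q V \<equiv> PiE V (\<lambda>_. {..<q})"

definition depends_on :: "'a set \<Rightarrow> (('a \<Rightarrow> nat) \<Rightarrow> bool) \<Rightarrow> bool" where
  "depends_on D P \<longleftrightarrow> (\<forall>f g. (\<forall>x\<in>D. f x = g x) \<longrightarrow> P f = P g)"

lemma depends_onD: "depends_on D P \<Longrightarrow> (\<And>x. x \<in> D \<Longrightarrow> f x = g x) \<Longrightarrow> P f = P g"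
  unfolding depends_on_def by blast

lemma card_colourings_split:
  assumes "D \<subseteq> V" and P: "depends_on D P" and Q: "depends_on (V - D) Q"
  shows "card {f \<in> colourings q V. P f \<and> Q f} =
    card {g \<in> colourings q D. P g} * card {h \<in> colourings q (V - D). Q h}"
proof -
  let ?S = "{f \<in> colourings q V. P f \<and> Q f}"
  let ?T = "{g \<in> colourings q D. P g} \<times> {h \<in> colourings q (V - D). Q h}"
  have restr: "P (restrict f D) = P f" "Q (restrict f (V - D)) = Q f" for f
    by (rule depends_onD[OF P], simp, rule depends_onD[OF Q], simp)
  have "bij_betw (\<lambda>f. (restrict f D, restrict f (V - D))) ?S ?T"
  proof (rule bij_betwI[where g = "\<lambda>(g, h) x. if x \<in> D then g x else h x"])
    show "(\<lambda>f. (restrict f D, restrict f (V - D))) \<in> ?S \<rightarrow> ?T"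
    proof
      fix f assume f: "f \<in> ?S"
      then have "restrict f D \<in> colourings q D" "restrict f (V - D) \<in> colourings q (V - D)"
        using \<open>D \<subseteq> V\<close> by (auto simp: PiE_iff)
      then show "(restrict f D, restrict f (V - D)) \<in> ?T"
        using f by (simp only: mem_Collect_eq mem_Sigma_iff restr simp_thms)
    qed
    show "(\<lambda>(g, h) x. if x \<in> D then g x else h x) \<in> ?T \<rightarrow> ?S"
    proof (clarify, intro CollectI conjI)
      fix g h assume g: "g \<in> colourings q D" "P g" and h: "h \<in> colourings q (V - D)" "Q h"
      show "(\<lambda>x. if x \<in> D then g x else h x) \<in> colourings q V"
        using g(1) h(1) \<open>D \<subseteq> V\<close> by (auto simp: PiE_iff extensional_def)
      have "P (\<lambda>x. if x \<in> D then g x else h x) = P g"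
        by (rule depends_onD[OF P]) simp
      then show "P (\<lambda>x. if x \<in> D then g x else h x)" using g(2) by simp
      have "Q (\<lambda>x. if x \<in> D then g x else h x) = Q h"
        by (rule depends_onD[OF Q]) simp
      then show "Q (\<lambda>x. if x \<in> D then g x else h x)" using h(2) by simp
    qed
    show "(\<lambda>(g, h) x. if x \<in> D then g x else h x) (restrict f D, restrict f (V - D)) = f"
      if "f \<in> ?S" for f
      using that \<open>D \<subseteq> V\<close> by (auto simp: PiE_iff extensional_def fun_eq_iff)
    show "(restrict ((\<lambda>(g, h) x. if x \<in> D then g x else h x) p) D,
        restrict ((\<lambda>(g, h) x. if x \<in> D then g x else h x) p) (V - D)) = p"
      if "p \<in> ?T" for p
      using that by (auto simp: PiE_iff extensional_def fun_eq_iff)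
  qed
  then have "card ?S = card ?T" by (rule bij_betw_same_card)
  then show ?thesis by (simp only: card_cartesian_product)
qed

text \<open>
  Independence of events determined by disjoint sets of points, with cardinalities in place of
  probabilities.
\<close>

lemma card_colourings_independent:
  assumes "D \<subseteq> V" and P: "depends_on D P" and Q: "depends_on (V - D) Q"
  shows "card {f \<in> colourings q V. P f \<and> Q f} * card (colourings q V) =
    card {f \<in> colourings q V. P f} * card {f \<in> colourings q V. Q f}"
proof -
  have T: "depends_on S (\<lambda>_. True)" for S :: "'a set" by (simp add: depends_on_def)
  show ?thesis
    using card_colourings_split[OF assms, of q] card_colourings_split[OF \<open>D \<subseteq> V\<close> P T, of q]
      card_colourings_split[OF \<open>D \<subseteq> V\<close> T Q, of q] card_colourings_split[OF \<open>D \<subseteq> V\<close> T T, of q]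
    by simp
qed

text \<open>
  The weight \<open>1 / (\<delta> + 2)\<close> instead of the usual \<open>1 / (\<delta> + 1)\<close> is below \<open>1\<close> also for \<open>\<delta> = 0\<close>, and
  still satisfies the inequality that the induction in the local lemma needs, because
  \<open>exp (1 / (\<delta> + 1)) \<ge> (\<delta> + 2) / (\<delta> + 1)\<close>.
\<close>

lemma local_lemma_weight:
  fixes \<delta> :: real
  assumes "\<delta> \<ge> 0" and "real m \<le> \<delta>"
  defines "x \<equiv> 1 / (\<delta> + 2)"
  shows "exp (-1) / (\<delta> + 1) \<le> x * (1 - x) ^ m"
proof -
  have x: "1 - x = inverse (1 + 1 / (\<delta> + 1))"
    using \<open>\<delta> \<ge> 0\<close> by (simp add: x_def field_simps)
  have "inverse (exp (1 / (\<delta> + 1))) \<le> inverse (1 + 1 / (\<delta> + 1))"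
    using \<open>\<delta> \<ge> 0\<close> by (intro le_imp_inverse_le exp_ge_add_one_self) (simp add: add_pos_nonneg)
  then have base: "exp (- (1 / (\<delta> + 1))) \<le> 1 - x"
    by (simp only: x exp_minus)
  have "exp (-1) * (1 + 1 / (\<delta> + 1)) \<le> exp (-1) * exp (1 / (\<delta> + 1))"
    by (intro mult_left_mono exp_ge_add_one_self) simp
  also have "\<dots> = exp (- (\<delta> * (1 / (\<delta> + 1))))"
    using \<open>\<delta> \<ge> 0\<close> by (simp add: mult_exp_exp field_simps)
  also have "\<dots> \<le> exp (- (real m * (1 / (\<delta> + 1))))"
    using assms by (simp add: divide_right_mono)
  also have "\<dots> = exp (- (1 / (\<delta> + 1))) ^ m"
    by (simp add: exp_of_nat_mult[symmetric])
  also have "\<dots> \<le> (1 - x) ^ m"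
    using base by (intro power_mono) simp_all
  finally have "x * (exp (-1) * (1 + 1 / (\<delta> + 1))) \<le> x * (1 - x) ^ m"
    using \<open>\<delta> \<ge> 0\<close> by (intro mult_left_mono) (simp_all add: x_def)
  moreover have "x * (1 + 1 / (\<delta> + 1)) = 1 / (\<delta> + 1)"
    using \<open>\<delta> \<ge> 0\<close> by (simp add: x_def field_simps)
  then have "x * (exp (-1) * (1 + 1 / (\<delta> + 1))) = exp (-1) / (\<delta> + 1)"
    by (metis mult.left_commute times_divide_eq_right mult.right_neutral)
  ultimately show ?thesis by simp
qed

text \<open>
  The usual induction: given that the events of \<open>S\<close> are avoided, any further event \<open>i\<close> has
  conditional probability at most \<open>x = 1 / (\<delta> + 2)\<close>. Avoiding the events of \<open>S\<close> that share no point with \<open>i\<close>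
  is independent of \<open>i\<close>, and each of the at most \<open>\<delta>\<close> others costs a factor \<open>1 - x\<close> by the induction
  hypothesis.
\<close>

theorem finite_local_lemma:
  fixes bad :: "'i \<Rightarrow> ('a \<Rightarrow> nat) \<Rightarrow> bool" and \<delta> :: real
  assumes "finite V" "finite I" "q > 0" "\<delta> \<ge> 0"
    and D: "\<And>i. i \<in> I \<Longrightarrow> D i \<subseteq> V" "\<And>i. i \<in> I \<Longrightarrow> depends_on (D i) (bad i)"
    and prob: "\<And>i. i \<in> I \<Longrightarrow> real (card {f \<in> colourings q V. bad i f})
      \<le> exp (-1) / (\<delta> + 1) * real (card (colourings q V))"
    and deg: "\<And>i. i \<in> I \<Longrightarrow> real (card {j \<in> I. j \<noteq> i \<and> D j \<inter> D i \<noteq> {}}) \<le> \<delta>"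
  shows "\<exists>f\<in>colourings q V. \<forall>i\<in>I. \<not> bad i f"
proof -
  let ?\<Omega> = "colourings q V"
  define N where "N S = real (card {f \<in> ?\<Omega>. \<forall>j\<in>S. \<not> bad j f})" for S
  define E where "E i S = real (card {f \<in> ?\<Omega>. bad i f \<and> (\<forall>j\<in>S. \<not> bad j f)})" for i S
  define x where "x = 1 / (\<delta> + 2)"
  have x: "0 < x" "x < 1" using \<open>\<delta> \<ge> 0\<close> by (simp_all add: x_def)
  have fin: "finite ?\<Omega>" using \<open>finite V\<close> by (simp add: finite_PiE)
  have pos: "card ?\<Omega> > 0" using \<open>finite V\<close> \<open>q > 0\<close> by (simp add: card_PiE)
  have split: "N (insert i S) = N S - E i S" for i S
  proof -
    have "{f \<in> ?\<Omega>. \<forall>j\<in>S. \<not> bad j f} =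
        {f \<in> ?\<Omega>. \<forall>j\<in>insert i S. \<not> bad j f} \<union> {f \<in> ?\<Omega>. bad i f \<and> (\<forall>j\<in>S. \<not> bad j f)}"
      by blast
    then have "card {f \<in> ?\<Omega>. \<forall>j\<in>S. \<not> bad j f} =
        card {f \<in> ?\<Omega>. \<forall>j\<in>insert i S. \<not> bad j f} +
        card {f \<in> ?\<Omega>. bad i f \<and> (\<forall>j\<in>S. \<not> bad j f)}"
      using fin by (simp only: card_Un_disjoint[of "{f \<in> ?\<Omega>. \<forall>j\<in>insert i S. \<not> bad j f}"
            "{f \<in> ?\<Omega>. bad i f \<and> (\<forall>j\<in>S. \<not> bad j f)}"]) (subst card_Un_disjoint; auto)
    then show ?thesis by (simp add: N_def E_def)
  qed
  (* avoiding the events of T one after the other costs at most a factor 1 - x each *)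
  have chain: "(1 - x) ^ card T * N S \<le> N (S \<union> T)"
    if "finite T" and step: "\<And>j T'. j \<in> T \<Longrightarrow> T' \<subseteq> T \<Longrightarrow> j \<notin> T' \<Longrightarrow> E j (S \<union> T') \<le> x * N (S \<union> T')"
    for S T
    using that
  proof (induction T)
    case (insert j T)
    have "E j (S \<union> T) \<le> x * N (S \<union> T)"
      using insert.hyps by (intro insert.prems) auto
    then have "(1 - x) * N (S \<union> T) \<le> N (S \<union> insert j T)"
      using split[of j "S \<union> T"] by (simp add: algebra_simps)
    moreover have "(1 - x) ^ card T * N S \<le> N (S \<union> T)"
    proof (rule insert.IH)
      show "E i (S \<union> T') \<le> x * N (S \<union> T')" if "i \<in> T" "T' \<subseteq> T" "i \<notin> T'" for i T'
        using that by (intro insert.prems) auto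
    qed
    then have "(1 - x) * ((1 - x) ^ card T * N S) \<le> (1 - x) * N (S \<union> T)"
      using x by (intro mult_left_mono) simp_all
    ultimately show ?case using insert.hyps by simp
  qed simp
  have claim: "E i S \<le> x * N S" if "S \<subseteq> I" "i \<in> I" "i \<notin> S" for i S
    using that
  proof (induction "card S" arbitrary: S i rule: less_induct)
    case less
    have "finite S" using less.prems \<open>finite I\<close> finite_subset by blast
    define S1 where "S1 = {j \<in> S. D j \<inter> D i \<noteq> {}}"
    define S2 where "S2 = S - S1"
    have S: "S2 \<union> S1 = S" "S2 \<inter> S1 = {}" "finite S1"
      using \<open>finite S\<close> by (auto simp: S1_def S2_def)
    have "E i S \<le> E i S2"
      unfolding E_def of_nat_le_iff using fin by (intro card_mono) (auto simp: S2_def)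
    moreover have "E i S2 * card ?\<Omega> = real (card {f \<in> ?\<Omega>. bad i f}) * N S2"
    proof -
      have "depends_on (V - D i) (\<lambda>f. \<forall>j\<in>S2. \<not> bad j f)"
        unfolding depends_on_def
      proof (intro allI impI)
        fix f g :: "'a \<Rightarrow> nat" assume eq: "\<forall>x\<in>V - D i. f x = g x"
        have "bad j f = bad j g" if "j \<in> S2" for j
        proof -
          have "j \<in> I" "D j \<inter> D i = {}" using that less.prems by (auto simp: S1_def S2_def)
          then have "D j \<subseteq> V - D i" using D(1) by blast
          then show ?thesis using eq by (intro depends_onD[OF D(2)[OF \<open>j \<in> I\<close>]]) blast
        qed
        then show "(\<forall>j\<in>S2. \<not> bad j f) = (\<forall>j\<in>S2. \<not> bad j g)" by blast
      qed
      from card_colourings_independent[OF D(1)[OF \<open>i \<in> I\<close>] D(2)[OF \<open>i \<in> I\<close>] this, of q]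
      show ?thesis unfolding E_def N_def of_nat_mult[symmetric] by simp
    qed
    then have "E i S2 * card ?\<Omega> \<le> (exp (-1) / (\<delta> + 1) * card ?\<Omega>) * N S2"
      using mult_right_mono[OF prob[OF \<open>i \<in> I\<close>], of "N S2"] by (simp add: N_def)
    then have "E i S2 * card ?\<Omega> \<le> (exp (-1) / (\<delta> + 1) * N S2) * card ?\<Omega>"
      by (simp only: mult_ac)
    then have "E i S2 \<le> exp (-1) / (\<delta> + 1) * N S2"
      by (rule mult_right_le_imp_le) (use pos in simp)
    moreover have "\<dots> \<le> x * (1 - x) ^ card S1 * N S2"
    proof (rule mult_right_mono)
      have "card S1 \<le> card {j \<in> I. j \<noteq> i \<and> D j \<inter> D i \<noteq> {}}"
        using less.prems \<open>finite I\<close> by (intro card_mono) (auto simp: S1_def)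
      then have "real (card S1) \<le> \<delta>" using deg[OF \<open>i \<in> I\<close>] by linarith
      then show "exp (-1) / (\<delta> + 1) \<le> x * (1 - x) ^ card S1"
        unfolding x_def by (rule local_lemma_weight[OF \<open>\<delta> \<ge> 0\<close>])
    qed (simp add: N_def)
    moreover have "(1 - x) ^ card S1 * N S2 \<le> N (S2 \<union> S1)"
    proof (rule chain[OF \<open>finite S1\<close>])
      fix j T' assume j: "j \<in> S1" "T' \<subseteq> S1" "j \<notin> T'"
      have jS: "j \<in> S" "j \<notin> S2 \<union> T'" "S2 \<union> T' \<subseteq> S" using j S by (auto simp: S1_def)
      then have "card (S2 \<union> T') < card S"
        using \<open>finite S\<close> by (intro psubset_card_mono) auto
      then show "E j (S2 \<union> T') \<le> x * N (S2 \<union> T')"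
        using jS less.prems by (intro less.hyps) auto
    qed
    then have "x * ((1 - x) ^ card S1 * N S2) \<le> x * N S"
      using x S(1) by (intro mult_left_mono) simp_all
    ultimately show ?case by (simp add: mult.assoc)
  qed
  have "(1 - x) ^ card I * N {} \<le> N ({} \<union> I)"
    using claim by (intro chain \<open>finite I\<close>) auto
  moreover have "0 < (1 - x) ^ card I * N {}" using pos x by (simp add: N_def)
  ultimately have "N I > 0" by simp
  then have "{f \<in> ?\<Omega>. \<forall>j\<in>I. \<not> bad j f} \<noteq> {}" unfolding N_def by (metis card.empty of_nat_0 less_irrefl)
  then show ?thesis by blast
qed


section \<open>Borel families of constraints as Borel sets of tuples\<close>

text \<open>
  This is how Borel maps into spaces of finite sets arise here: both the graphs of partial functions
  and the constraints themselves are listed without repetition by Borel maps.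
\<close>

lemma measurable_finite_image:
  fixes k :: nat
  assumes g: "\<And>i. i < k \<Longrightarrow> g i \<in> P \<rightarrow>\<^sub>M N"
    and inj: "\<And>p. p \<in> space P \<Longrightarrow> inj_on (\<lambda>i. g i p) {..<k}"
  shows "(\<lambda>p. (\<lambda>i. g i p) ` {..<k}) \<in> P \<rightarrow>\<^sub>M finite_subsets N"
proof (rule measurableI)
  show "(\<lambda>i. g i p) ` {..<k} \<in> space (finite_subsets N)" if "p \<in> space P" for p
    using measurable_space[OF g that] by (auto simp: space_finite_subsets)
  fix A assume "A \<in> sets (finite_subsets N)"
  then have A: "{x \<in> space (distinct_tuples N k). x ` {..<k} \<in> A} \<in> sets (distinct_tuples N k)"
    by (simp add: sets_finite_subsets)
  define e where "e p = (\<lambda>i\<in>{..<k}. g i p)" for p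
  have e: "e \<in> P \<rightarrow>\<^sub>M distinct_tuples N k"
    unfolding distinct_tuples_def
  proof (rule measurable_restrict_space2)
    show "e \<in> space P \<rightarrow> {x. inj_on x {..<k}}"
      using inj by (auto simp: e_def inj_on_def)
    show "e \<in> P \<rightarrow>\<^sub>M PiM {..<k} (\<lambda>_. N)"
      unfolding e_def by (rule measurable_restrict) (use g in simp)
  qed
  have img: "e p ` {..<k} = (\<lambda>i. g i p) ` {..<k}" for p
    by (auto simp: e_def)
  have "(\<lambda>p. (\<lambda>i. g i p) ` {..<k}) -` A \<inter> space P =
      e -` {x \<in> space (distinct_tuples N k). x ` {..<k} \<in> A} \<inter> space P"
    using measurable_space[OF e] by (auto simp: img)
  also have "\<dots> \<in> sets P" by (rule measurable_sets[OF e A])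
  finally show "(\<lambda>p. (\<lambda>i. g i p) ` {..<k}) -` A \<inter> space P \<in> sets P" .
qed

text \<open>
  A pattern \<open>\<pi>\<close> of colours is transported to the points \<open>t 0, \<dots>, t (n - 1)\<close>. A nonempty constraint
  with \<open>n\<close> points in its domain consists of the patterns of some set \<open>S\<close> placed at a tuple \<open>t\<close>
  listing the domain, which splits a family of constraints into countably many sets of tuples.
\<close>

definition placed :: "nat \<Rightarrow> (nat \<Rightarrow> 'a) \<Rightarrow> (nat \<Rightarrow> nat) \<Rightarrow> 'a \<rightharpoonup> nat" where
  "placed n t \<pi> x = (if x \<in> t ` {..<n} then Some (\<pi> (the_inv_into {..<n} t x)) else None)"

lemma placed_nth: "inj_on t {..<n} \<Longrightarrow> i < n \<Longrightarrow> placed n t \<pi> (t i) = Some (\<pi> i)"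
  by (simp add: placed_def the_inv_into_f_f)

lemma dom_placed: "dom (placed n t \<pi>) = t ` {..<n}"
  by (auto simp: placed_def dom_def)

lemma ran_placed: "inj_on t {..<n} \<Longrightarrow> ran (placed n t \<pi>) = \<pi> ` {..<n}"
proof (intro equalityI subsetI)
  fix v assume "inj_on t {..<n}" and "v \<in> ran (placed n t \<pi>)"
  then show "v \<in> \<pi> ` {..<n}"
    by (auto simp: ran_def placed_def the_inv_into_f_f split: if_splits)
next
  fix v assume inj: "inj_on t {..<n}" and "v \<in> \<pi> ` {..<n}"
  then obtain i where "i < n" "v = \<pi> i" by blast
  then have "placed n t \<pi> (t i) = Some v" using placed_nth[OF inj] by simp
  then show "v \<in> ran (placed n t \<pi>)" by (rule ranI)
qed

lemma graph_placed:
  assumes "inj_on t {..<n}"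
  shows "Map.graph (placed n t \<pi>) = (\<lambda>i. (t i, \<pi> i)) ` {..<n}"
  using assms by (auto simp: Map.graph_def placed_def the_inv_into_f_f split: if_splits)

lemma placed_eq_iff:
  assumes "inj_on t {..<n}" "\<pi> \<in> extensional {..<n}" "\<pi>' \<in> extensional {..<n}"
  shows "placed n t \<pi> = placed n t \<pi>' \<longleftrightarrow> \<pi> = \<pi>'"
proof
  assume eq: "placed n t \<pi> = placed n t \<pi>'"
  show "\<pi> = \<pi>'"
  proof (rule extensionalityI[OF assms(2,3)])
    fix i assume "i \<in> {..<n}"
    then show "\<pi> i = \<pi>' i" using placed_nth[OF assms(1), of i] eq by (metis lessThan_iff option.inject)
  qed
qed simp

lemma placed_measurable:
  assumes "\<pi> \<in> colourings q {..<n}"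
  shows "(\<lambda>t. placed n t \<pi>) \<in> distinct_tuples M n \<rightarrow>\<^sub>M finite_partial_functions M q"
  unfolding finite_partial_functions_def
proof (rule measurable_vimage_algebra2)
  have inj: "inj_on t {..<n}" if "t \<in> space (distinct_tuples M n)" for t
    using that by (simp add: distinct_tuples_def space_restrict_space)
  have "t i \<in> space M" if "t \<in> space (distinct_tuples M n)" "i < n" for t i
    using that by (auto simp: distinct_tuples_def space_restrict_space space_PiM)
  then have "t ` {..<n} \<subseteq> space M" if "t \<in> space (distinct_tuples M n)" for t
    using that by blast
  moreover have "\<pi> ` {..<n} \<subseteq> {..<q}" using assms by auto
  ultimately show "(\<lambda>t. placed n t \<pi>) \<in> space (distinct_tuples M n) \<rightarrow>
      {p. finite (dom p) \<and> dom p \<subseteq> space M \<and> ran p \<subseteq> {..<q}}"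
    by (intro funcsetI CollectI) (simp add: dom_placed ran_placed inj)
  have "(\<lambda>t. (\<lambda>i. (t i, \<pi> i)) ` {..<n})
      \<in> distinct_tuples M n \<rightarrow>\<^sub>M finite_subsets (M \<Otimes>\<^sub>M count_space {..<q})"
  proof (rule measurable_finite_image)
    show "(\<lambda>t. (t i, \<pi> i)) \<in> distinct_tuples M n \<rightarrow>\<^sub>M M \<Otimes>\<^sub>M count_space {..<q}" if "i < n" for i
    proof (rule measurable_Pair)
      show "(\<lambda>t. t i) \<in> distinct_tuples M n \<rightarrow>\<^sub>M M"
        unfolding distinct_tuples_def using that
        by (intro measurable_restrict_space1 measurable_component_singleton) simp
      show "(\<lambda>t. \<pi> i) \<in> distinct_tuples M n \<rightarrow>\<^sub>M count_space {..<q}"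
        using assms that by (intro measurable_const) auto
    qed
    show "inj_on (\<lambda>i. (t i, \<pi> i)) {..<n}" if "t \<in> space (distinct_tuples M n)" for t
      using inj[OF that] by (auto simp: inj_on_def)
  qed
  then show "(\<lambda>t. Map.graph (placed n t \<pi>))
      \<in> distinct_tuples M n \<rightarrow>\<^sub>M finite_subsets (M \<Otimes>\<^sub>M count_space {..<q})"
    by (rule measurable_cong[THEN iffD1, rotated]) (simp add: graph_placed inj)
qed

definition constraint_at :: "nat \<Rightarrow> (nat \<Rightarrow> 'a) \<Rightarrow> (nat \<Rightarrow> nat) set \<Rightarrow> ('a \<rightharpoonup> nat) set" where
  "constraint_at n t S = placed n t ` S"

lemma constraint_dom_at: "S \<noteq> {} \<Longrightarrow> constraint_dom (constraint_at n t S) = t ` {..<n}"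
  unfolding constraint_at_def by (rule constraint_dom_eq) (elim imageE, simp_all add: dom_placed)

lemma constraint_at_measurable:
  fixes M :: "'a measure"
  assumes S: "S \<subseteq> colourings q {..<n}"
  shows "(\<lambda>t. constraint_at n t S) \<in> distinct_tuples M n \<rightarrow>\<^sub>M Const M q"
proof -
  have inj: "inj_on t {..<n}" if "t \<in> space (distinct_tuples M n)" for t
    using that by (simp add: distinct_tuples_def space_restrict_space)
  have tM: "t ` {..<n} \<subseteq> space M" if "t \<in> space (distinct_tuples M n)" for t
    using that by (auto simp: distinct_tuples_def space_restrict_space space_PiM)
  have "finite S" using S by (rule finite_subset) (simp add: finite_PiE)
  then obtain e where e: "bij_betw e {..<card S} S"
    using ex_bij_betw_nat_finite by (metis lessThan_atLeast0)
  have eS: "e j \<in> S" if "j < card S" for j using bij_betwE[OF e] that by simp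
  have "(\<lambda>t. (\<lambda>j. placed n t (e j)) ` {..<card S})
      \<in> distinct_tuples M n \<rightarrow>\<^sub>M finite_subsets (finite_partial_functions M q)"
  proof (rule measurable_finite_image)
    show "(\<lambda>t. placed n t (e j)) \<in> distinct_tuples M n \<rightarrow>\<^sub>M finite_partial_functions M q"
      if "j < card S" for j
      using eS[OF that] S by (intro placed_measurable) blast
    show "inj_on (\<lambda>j. placed n t (e j)) {..<card S}" if "t \<in> space (distinct_tuples M n)" for t
    proof (rule inj_onI)
      fix i j assume ij: "i \<in> {..<card S}" "j \<in> {..<card S}" "placed n t (e i) = placed n t (e j)"
      then have "e i \<in> colourings q {..<n}" "e j \<in> colourings q {..<n}" using eS S by auto
      then have "e i = e j"
        using placed_eq_iff[OF inj[OF that], of "e i" "e j"] ij(3) by (simp add: PiE_iff)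
      then show "i = j" using e ij(1,2) by (auto simp: bij_betw_def dest: inj_onD)
    qed
  qed
  moreover have "(\<lambda>t :: nat \<Rightarrow> 'a. (\<lambda>j. placed n t (e j)) ` {..<card S}) = (\<lambda>t. constraint_at n t S)"
    by (simp add: constraint_at_def image_image[symmetric, of _ e] bij_betw_imp_surj_on[OF e])
  ultimately have "(\<lambda>t. constraint_at n t S)
      \<in> distinct_tuples M n \<rightarrow>\<^sub>M finite_subsets (finite_partial_functions M q)"
    by simp
  moreover have "is_constraint (space M) q (constraint_at n t S)"
    if "t \<in> space (distinct_tuples M n)" for t
    unfolding is_constraint_def
  proof (intro exI conjI ballI)
    fix p assume "p \<in> constraint_at n t S"
    then obtain \<pi> where "\<pi> \<in> S" "p = placed n t \<pi>" unfolding constraint_at_def by blast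
    moreover then have "\<pi> ` {..<n} \<subseteq> {..<q}" using S by auto
    ultimately show "dom p = t ` {..<n}" "ran p \<subseteq> {..<q}"
      using inj[OF that] by (simp_all add: dom_placed ran_placed)
  qed (use tM[OF that] in auto)
  ultimately show ?thesis
    unfolding Const_def by (intro measurable_restrict_space2) auto
qed

lemma is_constraint_eq_constraint_at:
  assumes "is_constraint X q B" and "B \<noteq> {}"
  obtains n t S where "t \<in> PiE {..<n} (\<lambda>_. X)" "inj_on t {..<n}" "S \<subseteq> colourings q {..<n}"
    "S \<noteq> {}" "B = constraint_at n t S"
proof -
  obtain D where "finite D" "D \<subseteq> X" "\<forall>p\<in>B. dom p = D \<and> ran p \<subseteq> {..<q}"
    using assms(1) unfolding is_constraint_def by (elim exE conjE)
  then have D: "finite D" "D \<subseteq> X" "\<And>p. p \<in> B \<Longrightarrow> dom p = D" "\<And>p. p \<in> B \<Longrightarrow> ran p \<subseteq> {..<q}"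
    by simp_all
  obtain e where e: "bij_betw e {..<card D} D"
    using ex_bij_betw_nat_finite[OF D(1)] by (metis lessThan_atLeast0)
  define n where "n = card D"
  define t where "t = restrict e {..<n}"
  have t: "bij_betw t {..<n} D"
    using e unfolding t_def n_def by (subst bij_betw_cong[of _ _ e]) simp_all
  then have inj: "inj_on t {..<n}" and img: "t ` {..<n} = D" by (auto simp: bij_betw_def)
  define \<pi> where "\<pi> p = (\<lambda>i\<in>{..<n}. the (p (t i)))" for p :: "'a \<rightharpoonup> nat"
  have placed: "placed n t (\<pi> p) = p" if "p \<in> B" for p
  proof
    fix x
    show "placed n t (\<pi> p) x = p x"
    proof (cases "x \<in> D")
      case True
      then obtain i where i: "i < n" "x = t i" using img by auto
      moreover have "p x \<noteq> None" using True D(3)[OF that] by (auto simp: dom_def)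
      ultimately show ?thesis using placed_nth[OF inj i(1), of "\<pi> p"] by (simp add: \<pi>_def)
    next
      case False
      then have "p x = None" using D(3)[OF that] by (auto simp: dom_def)
      then show ?thesis using False img by (simp add: placed_def)
    qed
  qed
  have "\<pi> p i < q" if "p \<in> B" "i < n" for p i
  proof -
    have "t i \<in> dom p" using D(3)[OF that(1)] img that(2) by auto
    then have "the (p (t i)) \<in> ran p" by (auto simp: dom_def ran_def)
    then show ?thesis using D(4)[OF that(1)] that(2) by (auto simp: \<pi>_def)
  qed
  then have "\<pi> ` B \<subseteq> colourings q {..<n}"
    by (auto simp: PiE_iff \<pi>_def extensional_def split: if_splits)
  moreover have "B = constraint_at n t (\<pi> ` B)"
    using placed by (auto simp: constraint_at_def image_image)
  moreover have "t \<in> PiE {..<n} (\<lambda>_. X)" using img D(2) by (auto simp: t_def PiE_iff)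
  ultimately show thesis using inj \<open>B \<noteq> {}\<close> by (intro that[of t n "\<pi> ` B"]) auto
qed

text \<open>
  Preimages of basic open sets under the embedding: they separate a point from a finite set
  because finite sets are closed.
\<close>

lemma standard_borel_separating_sequence:
  assumes "standard_borel M"
  shows "\<exists>C :: nat \<Rightarrow> 'a set. (\<forall>i. C i \<in> sets M) \<and>
    (\<forall>F x. finite F \<longrightarrow> F \<subseteq> space M \<longrightarrow> x \<in> space M - F \<longrightarrow> (\<exists>i. x \<in> C i \<and> C i \<inter> F = {}))"
proof -
  obtain \<phi> :: "'a \<Rightarrow> nat \<Rightarrow> real" where \<phi>: "\<phi> \<in> M \<rightarrow>\<^sub>M borel" "inj_on \<phi> (space M)"
    by (rule standard_borel_embedding[OF assms]) blast
  obtain \<B> :: "(nat \<Rightarrow> real) set set" where \<B>: "countable \<B>" "topological_basis \<B>"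
    using ex_countable_basis by blast
  have "\<B> \<noteq> {}" using topological_basisE[OF \<B>(2) open_UNIV UNIV_I] by blast
  define C where "C i = \<phi> -` (from_nat_into \<B> i) \<inter> space M" for i
  have "open (from_nat_into \<B> i)" for i
    using topological_basis_open[OF \<B>(2) from_nat_into[OF \<open>\<B> \<noteq> {}\<close>]] .
  then have "C i \<in> sets M" for i
    unfolding C_def by (intro measurable_sets[OF \<phi>(1)] borel_open)
  moreover have "\<exists>i. x \<in> C i \<and> C i \<inter> F = {}" if "finite F" "F \<subseteq> space M" "x \<in> space M - F" for F x
  proof -
    have "open (- (\<phi> ` F))" using that(1) by (intro open_Compl finite_imp_closed finite_imageI)
    moreover have "\<phi> x \<in> - (\<phi> ` F)"
      using that \<phi>(2) by (auto dest: inj_onD)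
    ultimately obtain V where V: "V \<in> \<B>" "\<phi> x \<in> V" "V \<subseteq> - (\<phi> ` F)"
      by (rule topological_basisE[OF \<B>(2)])
    obtain i where "from_nat_into \<B> i = V" using from_nat_into_surj[OF \<B>(1) V(1)] by blast
    then have "x \<in> C i" "C i \<inter> F = {}" using V that(3) unfolding C_def by auto
    then show ?thesis by blast
  qed
  ultimately show ?thesis by blast
qed


text \<open>
  The bound \<open>\<delta>\<close> is real, as it will be the value of \<open>CSP_d\<close> converted from the extended reals.
\<close>

locale borel_CSP_bounded_degree =
  fixes M :: "'a measure" and q :: nat and \<B> :: "('a \<rightharpoonup> nat) set set" and \<delta> :: real
  assumes M: "standard_borel M" and q: "q > 0" and \<B>: "borel_CSP M q \<B>" and \<delta>: "\<delta> \<ge> 0"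
    and degree: "\<And>B. B \<in> \<B> \<Longrightarrow>
      finite {B' \<in> \<B>. B' \<noteq> B \<and> constraint_dom B' \<inter> constraint_dom B \<noteq> {}} \<and>
      real (card {B' \<in> \<B>. B' \<noteq> B \<and> constraint_dom B' \<inter> constraint_dom B \<noteq> {}}) \<le> \<delta>"
begin

lemma is_constraint: "B \<in> \<B> \<Longrightarrow> is_constraint (space M) q B"
  using sets.sets_into_space[of \<B> "Const M q"] \<B>
  unfolding borel_CSP_def Const_def space_restrict_space by blast

lemma finite_dom: "B \<in> \<B> \<Longrightarrow> finite (constraint_dom B)"
  and dom_subset: "B \<in> \<B> \<Longrightarrow> constraint_dom B \<subseteq> space M"
proof -
  assume "B \<in> \<B>"
  then obtain D where D: "finite D" "D \<subseteq> space M" "\<forall>p\<in>B. dom p = D \<and> ran p \<subseteq> {..<q}"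
    using is_constraint unfolding is_constraint_def by meson
  then have "constraint_dom B \<subseteq> D" by (auto simp: constraint_dom_def)
  then show "finite (constraint_dom B)" "constraint_dom B \<subseteq> space M"
    using D finite_subset by auto
qed

lemma dom_ran: "B \<in> \<B> \<Longrightarrow> p \<in> B \<Longrightarrow> dom p = constraint_dom B \<and> ran p \<subseteq> {..<q}"
proof -
  assume B: "B \<in> \<B>" "p \<in> B"
  then obtain D where D: "\<forall>p\<in>B. dom p = D \<and> ran p \<subseteq> {..<q}"
    using is_constraint unfolding is_constraint_def by meson
  then have "constraint_dom B = D" using B(2) by (intro constraint_dom_eq) auto
  then show ?thesis using B D by simp
qed

definition placements :: "nat \<Rightarrow> (nat \<Rightarrow> nat) set \<Rightarrow> (nat \<Rightarrow> 'a) set" where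
  "placements n S = {t \<in> space (PiM {..<n} (\<lambda>_. M)). inj_on t {..<n} \<and> constraint_at n t S \<in> \<B>}"

definition patterns :: "nat \<Rightarrow> (nat \<Rightarrow> nat) set set" where
  "patterns n = {S. S \<subseteq> colourings q {..<n} \<and> S \<noteq> {}}"

lemma countable_patterns: "countable (patterns n)"
proof -
  have "finite (Pow (colourings q {..<n}))" by (simp add: finite_PiE)
  then show ?thesis
    by (rule countable_subset[OF _ countable_finite, rotated]) (auto simp: patterns_def)
qed

lemma placementsE:
  assumes "B \<in> \<B>" and "B \<noteq> {}"
  obtains n t S where "S \<in> patterns n" "t \<in> placements n S" "B = constraint_at n t S"
    "constraint_dom B = t ` {..<n}"
proof -
  obtain n t S where t: "t \<in> PiE {..<n} (\<lambda>_. space M)" "inj_on t {..<n}" "S \<subseteq> colourings q {..<n}"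
    "S \<noteq> {}" "B = constraint_at n t S"
    by (rule is_constraint_eq_constraint_at[OF is_constraint[OF assms(1)] assms(2)])
  show thesis
  proof (rule that)
    show "t \<in> placements n S"
      using t assms(1) by (simp add: placements_def space_PiM)
  qed (use t in \<open>simp_all add: patterns_def constraint_dom_at\<close>)
qed

lemma placementsD:
  assumes "t \<in> placements n S" and "S \<in> patterns n"
  shows "constraint_at n t S \<in> \<B>" "constraint_dom (constraint_at n t S) = t ` {..<n}"
    "inj_on t {..<n}" "t \<in> PiE {..<n} (\<lambda>_. space M)"
  using assms by (simp_all add: placements_def patterns_def constraint_dom_at space_PiM)

text \<open>
  The condition on the constraint is Borel relative to the tuples without repetition; these form a
  Borel set because the embedding into a Hausdorff space makes equality of coordinates a Borel
  condition.
\<close>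

lemma placements_borel:
  assumes "S \<in> patterns n"
  shows "placements n S \<in> sets (PiM {..<n} (\<lambda>_. M))"
proof -
  obtain \<phi> :: "'a \<Rightarrow> nat \<Rightarrow> real" where \<phi>: "\<phi> \<in> M \<rightarrow>\<^sub>M borel" "inj_on \<phi> (space M)"
    by (rule standard_borel_embedding[OF M]) blast
  let ?P = "PiM {..<n} (\<lambda>_. M)"
  define J where "J = {t \<in> space ?P. inj_on t {..<n}}"
  have coord: "(\<lambda>t. \<phi> (t i)) \<in> ?P \<rightarrow>\<^sub>M borel" if "i \<in> {..<n}" for i
    by (rule measurable_compose[OF _ \<phi>(1)]) (rule measurable_component_singleton[OF that])
  have "{t \<in> space ?P. \<phi> (t i) = \<phi> (t j)} \<in> sets ?P" if "i \<in> {..<n}" "j \<in> {..<n}" for i j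
    using coord[OF that(1)] coord[OF that(2)] by (rule measurable_equality_set)
  then have ne: "space ?P - {t \<in> space ?P. \<phi> (t i) = \<phi> (t j)} \<in> sets ?P"
    if "i \<in> {..<n}" "j \<in> {..<n}" for i j
    using that by blast
  define T where "T = {ij \<in> {..<n} \<times> {..<n}. fst ij \<noteq> snd ij}"
  have "J = space ?P \<inter> (\<Inter>ij\<in>T. space ?P - {t \<in> space ?P. \<phi> (t (fst ij)) = \<phi> (t (snd ij))})"
  proof (intro equalityI subsetI)
    fix t assume t: "t \<in> J"
    have "\<phi> (t i) \<noteq> \<phi> (t j)" if "i < n" "j < n" "i \<noteq> j" for i j
    proof -
      have "t i \<in> space M" "t j \<in> space M" using t that by (auto simp: J_def space_PiM)
      moreover have "t i \<noteq> t j" using t that by (auto simp: J_def dest: inj_onD)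
      ultimately show ?thesis using \<phi>(2) by (auto dest: inj_onD)
    qed
    then show "t \<in> space ?P \<inter> (\<Inter>ij\<in>T. space ?P - {t \<in> space ?P. \<phi> (t (fst ij)) = \<phi> (t (snd ij))})"
      using t by (auto simp: J_def T_def)
  next
    fix t assume t: "t \<in> space ?P \<inter> (\<Inter>ij\<in>T. space ?P - {t \<in> space ?P. \<phi> (t (fst ij)) = \<phi> (t (snd ij))})"
    have "\<phi> (t i) \<noteq> \<phi> (t j)" if "i < n" "j < n" "i \<noteq> j" for i j
    proof -
      have "(i, j) \<in> T" using that by (simp add: T_def)
      then have "t \<in> space ?P - {t \<in> space ?P. \<phi> (t (fst (i, j))) = \<phi> (t (snd (i, j)))}"
        using t by blast
      then show ?thesis by simp
    qed
    then have "inj_on t {..<n}" by (intro inj_onI) (metis lessThan_iff)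
    then show "t \<in> J" using t by (simp add: J_def)
  qed
  moreover have "(\<Inter>ij\<in>T. space ?P - {t \<in> space ?P. \<phi> (t (fst ij)) = \<phi> (t (snd ij))}) \<in> sets ?P"
    if "T \<noteq> {}"
    using that by (intro sets.finite_INT ne) (auto simp: T_def)
  ultimately have J: "J \<in> sets ?P" by (cases "T = {}") auto
  have dt: "distinct_tuples M n = restrict_space ?P {t. inj_on t {..<n}}"
    by (simp add: distinct_tuples_def)
  have "(\<lambda>t. constraint_at n t S) -` \<B> \<inter> space (distinct_tuples M n) \<in> sets (distinct_tuples M n)"
    using assms \<B> unfolding borel_CSP_def patterns_def
    by (intro measurable_sets[OF constraint_at_measurable]) auto
  also have "(\<lambda>t. constraint_at n t S) -` \<B> \<inter> space (distinct_tuples M n) = placements n S"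
    by (auto simp: dt space_restrict_space placements_def)
  finally have "placements n S \<in> sets (distinct_tuples M n)" .
  then obtain A where "A \<in> sets ?P" "placements n S = {t. inj_on t {..<n}} \<inter> A"
    unfolding dt sets_restrict_space by blast
  then have "placements n S = A \<inter> J"
    using sets.sets_into_space[of A ?P] by (auto simp: J_def)
  then show ?thesis using \<open>A \<in> sets ?P\<close> J by auto
qed

lemma constraints_at_point:
  "finite {B \<in> \<B>. x \<in> constraint_dom B}" "real (card {B \<in> \<B>. x \<in> constraint_dom B}) \<le> \<delta> + 1"
proof -
  let ?A = "{B \<in> \<B>. x \<in> constraint_dom B}"
  have "finite ?A \<and> real (card ?A) \<le> \<delta> + 1"
  proof (cases "?A = {}")
    case True
    show ?thesis unfolding True using \<delta> by simp
  next
    case False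
    then obtain B where B: "B \<in> \<B>" "x \<in> constraint_dom B" by blast
    let ?N = "{B' \<in> \<B>. B' \<noteq> B \<and> constraint_dom B' \<inter> constraint_dom B \<noteq> {}}"
    have "?A \<subseteq> insert B ?N" using B by blast
    moreover have "finite ?N" "real (card ?N) \<le> \<delta>" using degree[OF B(1)] by simp_all
    moreover have "card (insert B ?N) \<le> Suc (card ?N)" by (rule card_insert_le_m1) simp_all
    ultimately have "finite ?A" "card ?A \<le> Suc (card ?N)"
      by (meson finite_insert finite_subset, meson card_mono finite_insert le_trans)
    then show ?thesis using \<open>real (card ?N) \<le> \<delta>\<close> by linarith
  qed
  then show "finite ?A" "real (card ?A) \<le> \<delta> + 1" by simp_all
qed

text \<open>
  A point lies in the domain of at most \<open>\<delta> + 1\<close> constraints, and a domain of size \<open>n\<close> is listed by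
  at most \<open>n ^ n\<close> tuples; this bounds the fibres of the coordinate map.
\<close>

lemma placements_image_borel:
  assumes S: "S \<in> patterns n" and A: "A \<subseteq> placements n S" "A \<in> sets (PiM {..<n} (\<lambda>_. M))"
    and "a < n"
  shows "(\<lambda>t. t a) ` A \<in> sets M"
proof (rule standard_borel_coordinate_image[OF M A(2) \<open>a < n\<close>])
  fix x
  define \<C> where "\<C> = {B \<in> \<B>. x \<in> constraint_dom B \<and> card (constraint_dom B) = n}"
  have \<C>: "finite \<C>" "real (card \<C>) \<le> \<delta> + 1"
  proof -
    have "\<C> \<subseteq> {B \<in> \<B>. x \<in> constraint_dom B}" by (auto simp: \<C>_def)
    then show "finite \<C>" "real (card \<C>) \<le> \<delta> + 1"
      using constraints_at_point[of x] card_mono[of "{B \<in> \<B>. x \<in> constraint_dom B}" \<C>]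
      by (auto intro: finite_subset)
  qed
  let ?T = "\<Union>B\<in>\<C>. PiE {..<n} (\<lambda>_. constraint_dom B)"
  have sub: "{t \<in> A. t a = x} \<subseteq> ?T"
  proof
    fix t assume t: "t \<in> {t \<in> A. t a = x}"
    then have tp: "t \<in> placements n S" using A by blast
    note d = placementsD[OF this S]
    have "x \<in> t ` {..<n}" using t \<open>a < n\<close> by blast
    then have "constraint_at n t S \<in> \<C>"
      using d by (simp add: \<C>_def card_image)
    moreover have "t \<in> PiE {..<n} (\<lambda>_. constraint_dom (constraint_at n t S))"
      using d(4) by (auto simp: d(2) PiE_iff)
    ultimately show "t \<in> ?T" by blast
  qed
  have fin: "finite ?T"
    using \<C>(1) finite_dom by (intro finite_UN_I finite_PiE) (auto simp: \<C>_def)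
  have "card ?T \<le> (\<Sum>B\<in>\<C>. card (PiE {..<n} (\<lambda>_. constraint_dom B)))"
    by (rule card_UN_le[OF \<C>(1)])
  also have "\<dots> = (\<Sum>B\<in>\<C>. n ^ n)"
    by (intro sum.cong refl) (simp add: card_PiE \<C>_def)
  also have "\<dots> = card \<C> * n ^ n" by simp
  also have "\<dots> \<le> nat \<lfloor>\<delta> + 1\<rfloor> * n ^ n"
    by (rule mult_right_mono[OF le_nat_floor[OF \<C>(2)]]) simp
  finally show "finite {t \<in> A. t a = x} \<and> card {t \<in> A. t a = x} \<le> nat \<lfloor>\<delta> + 1\<rfloor> * n ^ n"
    using sub fin by (meson card_mono finite_subset le_trans)
qed

end


section \<open>Borel choice of solutions on finite components\<close>

text \<open>
  Colourings with finite codes: the first set in the list that contains \<open>x\<close> determines its colour.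
  Reducing modulo \<open>q\<close> makes every code legal.
\<close>

fun coded_colouring :: "nat \<Rightarrow> (nat \<Rightarrow> 'a set) \<Rightarrow> (nat \<times> nat) list \<Rightarrow> 'a \<Rightarrow> nat" where
  "coded_colouring q C [] x = 0"
| "coded_colouring q C ((i, v) # l) x = (if x \<in> C i then v mod q else coded_colouring q C l x)"

lemma coded_colouring_measurable:
  assumes "q > 0" "\<And>i. C i \<in> sets M"
  shows "coded_colouring q C l \<in> M \<rightarrow>\<^sub>M count_space {..<q}"
proof (induction l)
  case Nil
  then show ?case using \<open>q > 0\<close> by (simp add: fun_eq_iff[of "coded_colouring q C []"])
next
  case (Cons a l)
  obtain i v where a: "a = (i, v)" by fastforce
  have "coded_colouring q C (a # l) = (\<lambda>x. if x \<in> C i then v mod q else coded_colouring q C l x)"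
    by (simp add: a fun_eq_iff)
  moreover have "Measurable.pred M (\<lambda>x. x \<in> C i)"
    using assms(2)[of i] by simp
  ultimately show ?case
    using Cons \<open>q > 0\<close> by (simp add: measurable_If)
qed

text \<open>
  A further point \<open>x\<close> is served by a set that contains \<open>x\<close> and misses the points treated before; put
  in front of the list, it does not disturb them.
\<close>

lemma coded_colouring_dense:
  assumes C: "\<And>F x. finite F \<Longrightarrow> F \<subseteq> X \<Longrightarrow> x \<in> X - F \<Longrightarrow> \<exists>i. x \<in> C i \<and> C i \<inter> F = {}"
    and "finite F" "F \<subseteq> X" and f: "\<And>x. x \<in> F \<Longrightarrow> f x < q"
  shows "\<exists>l. \<forall>x\<in>F. coded_colouring q C l x = f x"
  using assms(2,3,4)
proof (induction F)
  case (insert x F)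
  then obtain l where l: "\<forall>y\<in>F. coded_colouring q C l y = f y" by blast
  obtain i where i: "x \<in> C i" "C i \<inter> F = {}" using C[of F x] insert by blast
  have "coded_colouring q C ((i, f x) # l) y = f y" if "y \<in> insert x F" for y
  proof (cases "y = x")
    case True
    then show ?thesis using i insert.prems(2)[of x] by simp
  next
    case False
    then have "y \<in> F" "y \<notin> C i" using that i by auto
    then show ?thesis using l by simp
  qed
  then show ?case by blast
qed simp

context borel_CSP_bounded_degree
begin

lemma dom_adjacent:
  assumes "B \<in> \<B>" "x \<in> constraint_dom B" "y \<in> constraint_dom B" "x \<in> U" "y \<in> U"
  shows "x = y \<or> (x, y) \<in> induced (CSP_graph \<B>) U"
  using assms by (auto simp: induced_def CSP_graph_def)

lemma sym_induced: "sym (induced (CSP_graph \<B>) U)"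
  by (auto simp: sym_def induced_def CSP_graph_def)

lemma neighbourhood_borel:
  assumes U: "U \<in> sets M" and A: "A \<in> sets M" "A \<subseteq> U"
  shows "{x. \<exists>y\<in>A. (x, y) \<in> induced (CSP_graph \<B>) U} \<in> sets M"
proof -
  define Q where "Q n S b = placements n S \<inter> {t \<in> space (PiM {..<n} (\<lambda>_. M)). t b \<in> A}" for n S b
  define T where "T = (SIGMA n:UNIV. patterns n \<times> {(a, b). a < n \<and> b < n \<and> a \<noteq> b})"
  have Q: "Q n S b \<in> sets (PiM {..<n} (\<lambda>_. M))" if "S \<in> patterns n" "b < n" for n S b
  proof -
    have "(\<lambda>t. t b) -` A \<inter> space (PiM {..<n} (\<lambda>_. M)) \<in> sets (PiM {..<n} (\<lambda>_. M))"
      by (rule measurable_sets[OF _ A(1)], rule measurable_component_singleton) (use that in simp)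
    also have "(\<lambda>t. t b) -` A \<inter> space (PiM {..<n} (\<lambda>_. M)) = {t \<in> space (PiM {..<n} (\<lambda>_. M)). t b \<in> A}"
      by blast
    finally show ?thesis unfolding Q_def using placements_borel[OF that(1)] by blast
  qed
  have "{x. \<exists>y\<in>A. (x, y) \<in> induced (CSP_graph \<B>) U} =
      U \<inter> (\<Union>(n, S, a, b)\<in>T. (\<lambda>t. t a) ` Q n S b)" (is "?L = ?R")
  proof (intro equalityI subsetI)
    fix x assume "x \<in> ?L"
    then obtain y B where y: "y \<in> A" "x \<in> U" "x \<noteq> y" and B: "B \<in> \<B>" "x \<in> constraint_dom B" "y \<in> constraint_dom B"
      unfolding induced_def CSP_graph_def by blast
    have "B \<noteq> {}" using B(2) by (auto simp: constraint_dom_def)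
    obtain n t S where t: "S \<in> patterns n" "t \<in> placements n S" "B = constraint_at n t S"
        "constraint_dom B = t ` {..<n}"
      by (rule placementsE[OF B(1) \<open>B \<noteq> {}\<close>])
    obtain a b where ab: "a < n" "x = t a" "b < n" "y = t b" using B t(4) by auto
    have "t \<in> Q n S b" using t(2) ab y(1) by (simp add: Q_def placements_def)
    moreover have "(n, S, a, b) \<in> T" using t(1) ab y(3) by (auto simp: T_def)
    ultimately have "x \<in> (\<Union>(n, S, a, b)\<in>T. (\<lambda>t. t a) ` Q n S b)"
      using ab(2) by (intro UN_I[of "(n, S, a, b)"]) auto
    then show "x \<in> ?R" using y(2) by blast
  next
    fix x assume x: "x \<in> ?R"
    then obtain n S a b t where t: "(n, S, a, b) \<in> T" "t \<in> Q n S b" "x = t a" by blast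
    then have S: "S \<in> patterns n" and ab: "a < n" "b < n" "a \<noteq> b" by (auto simp: T_def)
    have tp: "t \<in> placements n S" and "t b \<in> A" using t(2) by (auto simp: Q_def)
    note d = placementsD[OF tp S]
    have "t a \<noteq> t b" using d(3) ab by (auto dest: inj_onD)
    then have "(t a, t b) \<in> CSP_graph \<B>"
      using d(1,2) ab unfolding CSP_graph_def by blast
    then show "x \<in> ?L" using x t(3) \<open>t b \<in> A\<close> A(2) by (auto simp: induced_def)
  qed
  moreover have "(\<Union>(n, S, a, b)\<in>T. (\<lambda>t. t a) ` Q n S b) \<in> sets M"
  proof (rule sets.countable_UN'')
    show "countable T" unfolding T_def
      by (intro countable_SIGMA countable_patterns countableI_type)
    show "(case p of (n, S, a, b) \<Rightarrow> (\<lambda>t. t a) ` Q n S b) \<in> sets M" if p: "p \<in> T" for p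
    proof -
      obtain n S a b where eq: "p = (n, S, a, b)" by (metis prod_cases4)
      then have "S \<in> patterns n" "a < n" "b < n" using p by (auto simp: T_def)
      moreover have "Q n S b \<subseteq> placements n S" unfolding Q_def by (rule Int_lower1)
      ultimately have "(\<lambda>t. t a) ` Q n S b \<in> sets M"
        by (intro placements_image_borel[OF _ _ Q])
      then show ?thesis by (simp add: eq)
    qed
  qed
  ultimately show ?thesis using U by auto
qed

text \<open>
  The set \<open>Sat m\<close> collects the points whose component contains a point of a constraint on which the
  \<open>m\<close>-th coded colouring is bad. It is invariant under the component relation, and Borel as a countable
  union of iterated neighbourhoods of a coordinate image. Each point takes its colour from the first
  \<open>m\<close> with the point outside \<open>Sat m\<close>; such an \<open>m\<close> exists since some code realises a solution on the
  finite component. As a constraint meets \<open>U\<close> within one component, the choice of \<open>m\<close> is the same on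
  all its points.
\<close>

theorem borel_choice_on_finite_components:
  assumes U: "U \<in> sets M" and fin: "component_finite U (induced (CSP_graph \<B>) U)"
    and bad_local: "\<And>B. B \<in> \<B> \<Longrightarrow> depends_on (constraint_dom B \<inter> U) (bad B)"
    and bad_borel: "\<And>h n S. h \<in> M \<rightarrow>\<^sub>M count_space {..<q} \<Longrightarrow> S \<in> patterns n \<Longrightarrow>
      {t \<in> placements n S. bad (constraint_at n t S) h} \<in> sets (PiM {..<n} (\<lambda>_. M))"
    and solvable: "\<And>V. finite V \<Longrightarrow> V \<subseteq> U \<Longrightarrow> \<exists>f. (\<forall>x\<in>V. f x < q) \<and>
      (\<forall>B\<in>\<B>. constraint_dom B \<inter> U \<noteq> {} \<longrightarrow> constraint_dom B \<inter> U \<subseteq> V \<longrightarrow> \<not> bad B f)"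
  shows "\<exists>f. f \<in> M \<rightarrow>\<^sub>M count_space {..<q} \<and>
    (\<forall>B\<in>\<B>. constraint_dom B \<inter> U \<noteq> {} \<longrightarrow> \<not> bad B f)"
proof -
  define E where "E = induced (CSP_graph \<B>) U"
  have UM: "U \<subseteq> space M" using U by (rule sets.sets_into_space)
  have EU: "x \<in> U" "y \<in> U" if "(x, y) \<in> E" for x y using that by (auto simp: E_def induced_def)
  have symE: "sym (E\<^sup>*)" unfolding E_def by (intro sym_rtrancl sym_induced)
  obtain C :: "nat \<Rightarrow> 'a set" where CM: "\<And>i. C i \<in> sets M"
    and C: "\<And>F x. finite F \<Longrightarrow> F \<subseteq> space M \<Longrightarrow> x \<in> space M - F \<Longrightarrow> \<exists>i. x \<in> C i \<and> C i \<inter> F = {}"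
    using standard_borel_separating_sequence[OF M] by metis
  define h where "h m = coded_colouring q C (from_nat m)" for m :: nat
  have hM: "h m \<in> M \<rightarrow>\<^sub>M count_space {..<q}" for m
    unfolding h_def by (rule coded_colouring_measurable[OF q CM])
  define W where "W m = {x \<in> U. \<exists>B\<in>\<B>. x \<in> constraint_dom B \<and> bad B (h m)}" for m
  have W: "W m \<in> sets M" for m
  proof -
    define Q where "Q n S = {t \<in> placements n S. bad (constraint_at n t S) (h m)}" for n S
    define T where "T = (SIGMA n:UNIV. patterns n \<times> {a. a < n})"
    have "W m = U \<inter> (\<Union>(n, S, a)\<in>T. (\<lambda>t. t a) ` Q n S)" (is "_ = ?R")
    proof (intro equalityI subsetI)
      fix x assume "x \<in> W m"
      then obtain B where x: "x \<in> U" and B: "B \<in> \<B>" "x \<in> constraint_dom B" "bad B (h m)"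
        unfolding W_def by blast
      have "B \<noteq> {}" using B(2) by (auto simp: constraint_dom_def)
      obtain n t S where t: "S \<in> patterns n" "t \<in> placements n S" "B = constraint_at n t S"
          "constraint_dom B = t ` {..<n}"
        by (rule placementsE[OF B(1) \<open>B \<noteq> {}\<close>])
      obtain a where a: "a < n" "x = t a" using B(2) t(4) by auto
      have "t \<in> Q n S" using t B(3) by (simp add: Q_def)
      then have "x \<in> (\<Union>(n, S, a)\<in>T. (\<lambda>t. t a) ` Q n S)"
        using t(1) a by (intro UN_I[of "(n, S, a)"]) (auto simp: T_def)
      then show "x \<in> ?R" using x by blast
    next
      fix x assume x: "x \<in> ?R"
      then obtain n S a t where t: "(n, S, a) \<in> T" "t \<in> Q n S" "x = t a" by blast
      then have S: "S \<in> patterns n" and a: "a < n" by (auto simp: T_def)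
      have tp: "t \<in> placements n S" and "bad (constraint_at n t S) (h m)" using t(2) by (auto simp: Q_def)
      then show "x \<in> W m"
        using placementsD[OF tp S] a t(3) x unfolding W_def by blast
    qed
    moreover have "(\<Union>(n, S, a)\<in>T. (\<lambda>t. t a) ` Q n S) \<in> sets M"
    proof (rule sets.countable_UN'')
      show "countable T" unfolding T_def
        by (intro countable_SIGMA countable_patterns countableI_type)
      show "(case p of (n, S, a) \<Rightarrow> (\<lambda>t. t a) ` Q n S) \<in> sets M" if p: "p \<in> T" for p
      proof -
        obtain n S a where eq: "p = (n, S, a)" by (metis prod_cases3)
        then have "S \<in> patterns n" "a < n" using p by (auto simp: T_def)
        moreover then have "Q n S \<in> sets (PiM {..<n} (\<lambda>_. M))"
          unfolding Q_def by (intro bad_borel hM)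
        ultimately have "(\<lambda>t. t a) ` Q n S \<in> sets M"
          by (intro placements_image_borel) (auto simp: Q_def)
        then show ?thesis by (simp add: eq)
      qed
    qed
    ultimately show ?thesis using U by auto
  qed
  define Sat where "Sat m = {x \<in> U. \<exists>y\<in>W m. (x, y) \<in> E\<^sup>*}" for m
  have Sat: "Sat m \<in> sets M" for m
  proof -
    define L where "L j = {x. \<exists>y\<in>W m. (x, y) \<in> E ^^ j}" for j
    have L0: "L 0 = W m" by (auto simp: L_def)
    have LS: "L (Suc j) = {x. \<exists>y\<in>L j. (x, y) \<in> E}" for j
      by (auto simp: L_def relpow_commute[symmetric] elim!: relpow_Suc_E2 intro: relpow_Suc_I2)
    have LU: "L j \<in> sets M \<and> L j \<subseteq> U" for j
    proof (induction j)
      case 0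
      then show ?case unfolding L0 using W by (auto simp: W_def)
    next
      case (Suc j)
      then show ?case
        using neighbourhood_borel[OF U, of "L j"] EU(1) unfolding LS E_def by auto
    qed
    have "Sat m = (\<Union>j. L j)"
    proof (intro equalityI subsetI)
      fix x assume "x \<in> Sat m"
      then show "x \<in> (\<Union>j. L j)" by (auto simp: Sat_def L_def rtrancl_power)
    next
      fix x assume "x \<in> (\<Union>j. L j)"
      then obtain j where "x \<in> L j" by blast
      moreover from this have "x \<in> U" using LU by blast
      ultimately show "x \<in> Sat m" by (auto simp: Sat_def L_def rtrancl_power)
    qed
    then show ?thesis using LU by auto
  qed
  have Sat_inv: "x \<in> Sat m \<longleftrightarrow> y \<in> Sat m" if xy: "(x, y) \<in> E\<^sup>*" "x \<in> U" "y \<in> U" for x y m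
  proof -
    have "(y, x) \<in> E\<^sup>*" using symE xy(1) by (rule symD)
    then show ?thesis using xy unfolding Sat_def by (auto intro: rtrancl_trans)
  qed
  have good_code: "\<exists>m. x \<notin> Sat m" if x: "x \<in> U" for x
  proof -
    define V where "V = {y \<in> U. (x, y) \<in> E\<^sup>*}"
    have "finite V" using fin x unfolding V_def E_def component_finite_def by blast
    moreover have "V \<subseteq> U" by (auto simp: V_def)
    ultimately obtain f where f: "\<forall>x\<in>V. f x < q"
      "\<forall>B\<in>\<B>. constraint_dom B \<inter> U \<noteq> {} \<longrightarrow> constraint_dom B \<inter> U \<subseteq> V \<longrightarrow> \<not> bad B f"
      using solvable by metis
    have "\<exists>l. \<forall>x\<in>V. coded_colouring q C l x = f x"
    proof (rule coded_colouring_dense[OF C \<open>finite V\<close>])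
      show "V \<subseteq> space M" using \<open>V \<subseteq> U\<close> UM by blast
    qed (use f(1) in blast)+
    then obtain l where l: "\<forall>x\<in>V. coded_colouring q C l x = f x" by blast
    define m where "m = to_nat l"
    have hm: "h m y = f y" if "y \<in> V" for y using l that by (simp add: h_def m_def)
    have "x \<notin> Sat m"
    proof
      assume "x \<in> Sat m"
      then obtain y where y: "y \<in> W m" "(x, y) \<in> E\<^sup>*" unfolding Sat_def by blast
      then obtain B where B: "B \<in> \<B>" "y \<in> constraint_dom B" "bad B (h m)" and "y \<in> U"
        unfolding W_def by blast
      have sub: "constraint_dom B \<inter> U \<subseteq> V"
      proof
        fix z assume z: "z \<in> constraint_dom B \<inter> U"
        then have "y = z \<or> (y, z) \<in> E"
          using dom_adjacent[OF B(1,2)] \<open>y \<in> U\<close> unfolding E_def by blast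
        then have "(x, z) \<in> E\<^sup>*" using y(2) by (auto intro: rtrancl_into_rtrancl)
        then show "z \<in> V" using z by (simp add: V_def)
      qed
      have "bad B (h m) = bad B f"
        using sub hm by (intro depends_onD[OF bad_local[OF B(1)]]) blast
      moreover have "\<not> bad B f" using f(2) B(1,2) \<open>y \<in> U\<close> sub by blast
      ultimately show False using B(3) by simp
    qed
    then show ?thesis by blast
  qed
  define code where "code x = (LEAST m. x \<notin> Sat m)" for x
  have code: "x \<notin> Sat (code x)" if "x \<in> U" for x
    unfolding code_def by (rule LeastI_ex[OF good_code[OF that]])
  have code_inv: "code x = code y" if "(x, y) \<in> E\<^sup>*" "x \<in> U" "y \<in> U" for x y
    unfolding code_def using Sat_inv[OF that] by simp
  have code_meas: "code \<in> M \<rightarrow>\<^sub>M count_space UNIV"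
    unfolding code_def using Sat by measurable
  define f where "f x = h (code x) x" for x
  have "f \<in> M \<rightarrow>\<^sub>M count_space {..<q}"
    unfolding f_def by (rule measurable_compose_countable[OF hM code_meas])
  moreover have "\<not> bad B f" if B: "B \<in> \<B>" "constraint_dom B \<inter> U \<noteq> {}" for B
  proof -
    obtain x where x: "x \<in> constraint_dom B" "x \<in> U" using B(2) by blast
    have "f y = h (code x) y" if "y \<in> constraint_dom B \<inter> U" for y
    proof -
      have "x = y \<or> (x, y) \<in> E" using dom_adjacent[OF B(1) x(1)] that x(2) unfolding E_def by blast
      then have "code x = code y" using x(2) that by (intro code_inv) auto
      then show ?thesis by (simp add: f_def)
    qed
    then have "bad B f = bad B (h (code x))"
      by (intro depends_onD[OF bad_local[OF B(1)]])
    moreover have "x \<notin> W (code x)"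
      using code[OF x(2)] x(2) unfolding Sat_def by blast
    ultimately show ?thesis using x B(1) unfolding W_def by blast
  qed
  ultimately show ?thesis by blast
qed

end


section \<open>Revealing the colours in two rounds\<close>

definition agreeing :: "('a \<rightharpoonup> nat) set \<Rightarrow> 'a set \<Rightarrow> ('a \<Rightarrow> nat) \<Rightarrow> ('a \<rightharpoonup> nat) set" where
  "agreeing B W f = {p \<in> B. \<forall>x \<in> constraint_dom B \<inter> W. p x = Some (f x)}"

text \<open>
  The probability that \<open>B\<close> is violated when the points in \<open>W\<close> are coloured by \<open>f\<close> and all other
  points get independent uniform colours.
\<close>

definition cond_prob :: "nat \<Rightarrow> ('a \<rightharpoonup> nat) set \<Rightarrow> 'a set \<Rightarrow> ('a \<Rightarrow> nat) \<Rightarrow> real" where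
  "cond_prob q B W f = real (card (agreeing B W f)) / real q ^ card (constraint_dom B - W)"

lemma agreeing_cong:
  "(\<And>x. x \<in> constraint_dom B \<inter> W \<Longrightarrow> f x = g x) \<Longrightarrow> agreeing B W f = agreeing B W g"
  unfolding agreeing_def by (intro Collect_cong conj_cong ball_cong refl) simp

lemma cond_prob_cong:
  "(\<And>x. x \<in> constraint_dom B \<inter> W \<Longrightarrow> f x = g x) \<Longrightarrow> cond_prob q B W f = cond_prob q B W g"
  unfolding cond_prob_def using agreeing_cong[of B W f g] by simp

lemma cond_prob_empty: "cond_prob q B {} f = constraint_prob q B"
  by (simp add: cond_prob_def constraint_prob_def agreeing_def)

definition combine :: "'a set \<Rightarrow> ('a \<Rightarrow> nat) \<Rightarrow> ('a \<Rightarrow> nat) \<Rightarrow> 'a \<Rightarrow> nat" where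
  "combine W f h = (\<lambda>x. if x \<in> W then f x else h x)"

context borel_CSP_bounded_degree
begin

lemma finite_constraint:
  assumes "B \<in> \<B>"
  shows "finite B"
proof (rule finite_subset)
  show "B \<subseteq> {p. dom p = constraint_dom B \<and> ran p \<subseteq> {..<q}}"
    using dom_ran[OF assms] by blast
  show "finite {p. dom p = constraint_dom B \<and> ran p \<subseteq> {..<q}}"
    using finite_dom[OF assms] by (intro finite_set_of_finite_maps) simp_all
qed

text \<open>
  Double counting of pairs consisting of a colouring \<open>h\<close> of \<open>V\<close> and an element of \<open>B\<close> that agrees with
  \<open>f\<close> and \<open>h\<close>: such an element fixes \<open>h\<close> on the part of the domain inside \<open>U\<close> and leaves it free on the
  rest of \<open>V\<close>.
\<close>

lemma sum_agreeing:
  assumes B: "B \<in> \<B>" and V: "finite V" "constraint_dom B \<inter> U \<subseteq> V" "V \<subseteq> U" and disj: "U \<inter> W = {}"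
  shows "(\<Sum>h\<in>colourings q V. card (agreeing B (W \<union> U) (combine W f h))) * q ^ card (constraint_dom B \<inter> U)
    = card (agreeing B W f) * q ^ card V"
proof -
  let ?D = "constraint_dom B"
  have fin: "finite (colourings q V)" using V(1) by (simp add: finite_PiE)
  have finB: "finite (agreeing B W f)" using finite_constraint[OF B] by (simp add: agreeing_def)
  have DV: "?D \<inter> U \<subseteq> V" using V by blast
  have split: "agreeing B (W \<union> U) (combine W f h) =
      {p \<in> agreeing B W f. \<forall>x\<in>?D \<inter> U. h x = the (p x)}" for h
  proof (intro equalityI subsetI)
    fix p assume p: "p \<in> agreeing B (W \<union> U) (combine W f h)"
    then have pB: "p \<in> B" and eq: "\<And>x. x \<in> ?D \<Longrightarrow> x \<in> W \<union> U \<Longrightarrow> p x = Some (combine W f h x)"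
      unfolding agreeing_def by blast+
    have "p x = Some (f x)" if "x \<in> ?D \<inter> W" for x
      using eq[of x] that by (simp add: combine_def)
    moreover have "h x = the (p x)" if "x \<in> ?D \<inter> U" for x
    proof -
      have "x \<notin> W" using that disj by blast
      then show ?thesis using eq[of x] that by (simp add: combine_def)
    qed
    ultimately show "p \<in> {p \<in> agreeing B W f. \<forall>x\<in>?D \<inter> U. h x = the (p x)}"
      using pB unfolding agreeing_def by blast
  next
    fix p assume p: "p \<in> {p \<in> agreeing B W f. \<forall>x\<in>?D \<inter> U. h x = the (p x)}"
    then have pB: "p \<in> B" and W: "\<And>x. x \<in> ?D \<Longrightarrow> x \<in> W \<Longrightarrow> p x = Some (f x)"
      and U: "\<And>x. x \<in> ?D \<Longrightarrow> x \<in> U \<Longrightarrow> h x = the (p x)"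
      unfolding agreeing_def by blast+
    have "p x = Some (combine W f h x)" if "x \<in> ?D \<inter> (W \<union> U)" for x
    proof (cases "x \<in> W")
      case True
      then show ?thesis using W[of x] that by (simp add: combine_def)
    next
      case False
      moreover have "x \<in> dom p" using dom_ran[OF B pB] that by simp
      then have "p x = Some (the (p x))" by (simp add: domIff)
      ultimately show ?thesis using U[of x] that by (simp add: combine_def)
    qed
    then show "p \<in> agreeing B (W \<union> U) (combine W f h)"
      using pB unfolding agreeing_def by blast
  qed
  have count: "card {h \<in> colourings q V. \<forall>x\<in>?D \<inter> U. h x = the (p x)} * q ^ card (?D \<inter> U) = q ^ card V"
    if p: "p \<in> agreeing B W f" for p
  proof -
    let ?P = "\<lambda>h. \<forall>x\<in>?D \<inter> U. h x = the (p x)"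
    have pB: "p \<in> B" using p by (simp add: agreeing_def)
    have "depends_on (?D \<inter> U) ?P" by (simp add: depends_on_def)
    moreover have "depends_on (V - ?D \<inter> U) (\<lambda>_. True)" by (simp add: depends_on_def)
    ultimately have "card {h \<in> colourings q V. ?P h \<and> True} =
        card {h \<in> colourings q (?D \<inter> U). ?P h} * card {h \<in> colourings q (V - ?D \<inter> U). True}"
      by (rule card_colourings_split[OF DV])
    also have "{h \<in> colourings q (?D \<inter> U). ?P h} = {\<lambda>x\<in>?D \<inter> U. the (p x)}"
    proof (intro equalityI subsetI)
      fix h assume "h \<in> {h \<in> colourings q (?D \<inter> U). ?P h}"
      then have "h = (\<lambda>x\<in>?D \<inter> U. the (p x))"
        by (intro extensionalityI[of _ "?D \<inter> U"]) (auto simp: PiE_iff)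
      then show "h \<in> {\<lambda>x\<in>?D \<inter> U. the (p x)}" by simp
    next
      fix h assume "h \<in> {\<lambda>x\<in>?D \<inter> U. the (p x)}"
      then have h: "h = (\<lambda>x\<in>?D \<inter> U. the (p x))" by simp
      have "the (p x) < q" if "x \<in> ?D" for x
      proof -
        have "x \<in> dom p" using dom_ran[OF B pB] that by simp
        then have "the (p x) \<in> ran p" by (auto simp: ran_def)
        then show ?thesis using dom_ran[OF B pB] by blast
      qed
      then show "h \<in> {h \<in> colourings q (?D \<inter> U). ?P h}" by (simp add: h)
    qed
    finally have "card {h \<in> colourings q V. ?P h} = q ^ card (V - ?D \<inter> U)"
      using V(1) by (simp add: card_PiE)
    moreover have "card (V - ?D \<inter> U) + card (?D \<inter> U) = card V"
      using DV V(1) by (metis card_Diff_subset card_mono finite_subset le_add_diff_inverse2)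
    ultimately show ?thesis by (simp add: power_add[symmetric])
  qed
  have "(\<Sum>h\<in>colourings q V. card (agreeing B (W \<union> U) (combine W f h))) =
      (\<Sum>p\<in>agreeing B W f. card {h \<in> colourings q V. \<forall>x\<in>?D \<inter> U. h x = the (p x)})"
    unfolding split by (rule sum_multicount_gen[OF fin finB]) simp
  then show ?thesis
    by (simp add: sum_distrib_right count)
qed

text \<open>
  Averaging the conditional probability over the newly revealed colours returns the old one.
\<close>

lemma sum_cond_prob:
  assumes B: "B \<in> \<B>" and V: "finite V" "constraint_dom B \<inter> U \<subseteq> V" "V \<subseteq> U" and disj: "U \<inter> W = {}"
  shows "(\<Sum>h\<in>colourings q V. cond_prob q B (W \<union> U) (combine W f h)) =
    cond_prob q B W f * real (card (colourings q V))"
proof -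
  let ?D = "constraint_dom B"
  define c where "c = real q ^ card (?D - (W \<union> U))"
  define u where "u = real q ^ card (?D \<inter> U)"
  have pos: "c > 0" "u > 0" using q by (simp_all add: c_def u_def)
  have "?D - W = (?D - (W \<union> U)) \<union> (?D \<inter> U)" using disj by blast
  then have "card (?D - W) = card (?D - (W \<union> U)) + card (?D \<inter> U)"
    using finite_dom[OF B] by (simp add: card_Un_disjoint[symmetric] Int_Diff disjoint_iff)
  then have W: "cond_prob q B W f = real (card (agreeing B W f)) / (c * u)"
    by (simp add: cond_prob_def c_def u_def power_add)
  define s where "s = (\<Sum>h\<in>colourings q V. card (agreeing B (W \<union> U) (combine W f h)))"
  have "s * q ^ card (?D \<inter> U) = card (agreeing B W f) * q ^ card V"
    unfolding s_def by (rule sum_agreeing[OF assms])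
  then have "real s * u = real (card (agreeing B W f)) * real q ^ card V"
    unfolding u_def by (metis of_nat_mult of_nat_power)
  then have "real s = real (card (agreeing B W f)) * real q ^ card V / u"
    using pos by (simp add: field_simps)
  moreover have "(\<Sum>h\<in>colourings q V. cond_prob q B (W \<union> U) (combine W f h)) = real s / c"
    by (simp add: cond_prob_def s_def c_def sum_divide_distrib)
  moreover have "real (card (colourings q V)) = real q ^ card V"
    using V(1) by (simp add: card_PiE)
  ultimately show ?thesis using W by (simp add: mult.commute)
qed

lemma Markov_cond_prob:
  assumes B: "B \<in> \<B>" and V: "finite V" "constraint_dom B \<inter> U \<subseteq> V" "V \<subseteq> U" and disj: "U \<inter> W = {}"
    and "\<sigma> > 0" and small: "cond_prob q B W f \<le> \<sigma> * \<tau>"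
  shows "real (card {h \<in> colourings q V. cond_prob q B (W \<union> U) (combine W f h) \<ge> \<sigma>})
    \<le> \<tau> * real (card (colourings q V))"
proof -
  let ?c = "\<lambda>h. cond_prob q B (W \<union> U) (combine W f h)"
  let ?H = "{h \<in> colourings q V. ?c h \<ge> \<sigma>}"
  have fin: "finite (colourings q V)" using V(1) by (simp add: finite_PiE)
  have "real (card ?H) * \<sigma> = (\<Sum>h\<in>?H. \<sigma>)" by simp
  also have "\<dots> \<le> (\<Sum>h\<in>?H. ?c h)" by (rule sum_mono) simp
  also have "\<dots> \<le> (\<Sum>h\<in>colourings q V. ?c h)"
    by (rule sum_mono2[OF fin]) (auto simp: cond_prob_def)
  also have "\<dots> = cond_prob q B W f * real (card (colourings q V))"
    by (rule sum_cond_prob[OF B V disj])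
  also have "\<dots> \<le> \<sigma> * \<tau> * real (card (colourings q V))"
    by (rule mult_right_mono[OF small]) simp
  finally have "real (card ?H) * \<sigma> \<le> (\<tau> * real (card (colourings q V))) * \<sigma>"
    by (simp only: mult_ac)
  then show ?thesis by (rule mult_right_le_imp_le) fact
qed

text \<open>
  The bound on the probability of each event in the symmetric local lemma at dependency degree
  \<open>\<delta>\<close>.
\<close>

definition \<tau> :: real where "\<tau> = exp (-1) / (\<delta> + 1)"

lemma \<tau>_bounds: "0 < \<tau>" "\<tau> < 1"
proof -
  show "0 < \<tau>" using \<delta> by (simp add: \<tau>_def)
  have "exp (-1 :: real) < 1" by simp
  also have "1 \<le> \<delta> + 1" using \<delta> by simp
  finally show "\<tau> < 1" using \<delta> by (simp add: \<tau>_def)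
qed

text \<open>
  The local lemma for the events that a conditional probability reaches \<open>\<sigma>\<close>. Two such events share a
  point of \<open>U\<close> only if the domains of the constraints meet, so their dependency degree is at most \<open>\<delta>\<close>.
\<close>

lemma component_colouring:
  assumes V: "finite V" "V \<subseteq> U" and disj: "U \<inter> W = {}" and "\<sigma> > 0"
    and small: "\<And>B. B \<in> \<B> \<Longrightarrow> cond_prob q B W f \<le> \<sigma> * \<tau>"
  shows "\<exists>h. (\<forall>x\<in>V. h x < q) \<and> (\<forall>B\<in>\<B>. constraint_dom B \<inter> U \<noteq> {} \<longrightarrow>
    constraint_dom B \<inter> U \<subseteq> V \<longrightarrow> \<not> cond_prob q B (W \<union> U) (combine W f h) \<ge> \<sigma>)"
proof -
  define I where "I = {B \<in> \<B>. constraint_dom B \<inter> U \<noteq> {} \<and> constraint_dom B \<inter> U \<subseteq> V}"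
  define bad where "bad B h \<longleftrightarrow> cond_prob q B (W \<union> U) (combine W f h) \<ge> \<sigma>" for B h
  have "I \<subseteq> (\<Union>x\<in>V. {B \<in> \<B>. x \<in> constraint_dom B})" unfolding I_def by blast
  then have "finite I"
    by (rule finite_subset) (intro finite_UN_I V(1) constraints_at_point)
  have "\<exists>h\<in>colourings q V. \<forall>B\<in>I. \<not> bad B h"
  proof (rule finite_local_lemma[OF V(1) \<open>finite I\<close> q \<delta>])
    fix B assume "B \<in> I"
    then have B: "B \<in> \<B>" and sub: "constraint_dom B \<inter> U \<subseteq> V" by (simp_all add: I_def)
    show "constraint_dom B \<inter> U \<subseteq> V" by (rule sub)
    show "depends_on (constraint_dom B \<inter> U) (bad B)"
      unfolding depends_on_def
    proof (intro allI impI)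
      fix h h' :: "'a \<Rightarrow> nat" assume eq: "\<forall>x\<in>constraint_dom B \<inter> U. h x = h' x"
      have "cond_prob q B (W \<union> U) (combine W f h) = cond_prob q B (W \<union> U) (combine W f h')"
        by (rule cond_prob_cong) (use eq in \<open>auto simp: combine_def\<close>)
      then show "bad B h = bad B h'" by (simp add: bad_def)
    qed
    show "real (card {h \<in> colourings q V. bad B h}) \<le> exp (- 1) / (\<delta> + 1) * real (card (colourings q V))"
      unfolding bad_def \<tau>_def[symmetric]
      by (rule Markov_cond_prob[OF B V(1) sub V(2) disj \<open>\<sigma> > 0\<close> small[OF B]])
    have "{B' \<in> I. B' \<noteq> B \<and> constraint_dom B' \<inter> U \<inter> (constraint_dom B \<inter> U) \<noteq> {}}
        \<subseteq> {B' \<in> \<B>. B' \<noteq> B \<and> constraint_dom B' \<inter> constraint_dom B \<noteq> {}}"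
      unfolding I_def by blast
    then have "card {B' \<in> I. B' \<noteq> B \<and> constraint_dom B' \<inter> U \<inter> (constraint_dom B \<inter> U) \<noteq> {}}
        \<le> card {B' \<in> \<B>. B' \<noteq> B \<and> constraint_dom B' \<inter> constraint_dom B \<noteq> {}}"
      using degree[OF B] by (intro card_mono) simp_all
    then show "real (card {B' \<in> I. B' \<noteq> B \<and> constraint_dom B' \<inter> U \<inter> (constraint_dom B \<inter> U) \<noteq> {}}) \<le> \<delta>"
      using degree[OF B] by linarith
  qed
  then obtain h where h: "h \<in> colourings q V" "\<forall>B\<in>I. \<not> bad B h" by blast
  have "\<forall>x\<in>V. h x < q" using h(1) by auto
  moreover have "\<forall>B\<in>\<B>. constraint_dom B \<inter> U \<noteq> {} \<longrightarrow> constraint_dom B \<inter> U \<subseteq> V \<longrightarrow>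
      \<not> cond_prob q B (W \<union> U) (combine W f h) \<ge> \<sigma>"
    using h(2) unfolding I_def bad_def by blast
  ultimately show ?thesis by blast
qed

lemma cond_prob_constraint_at:
  assumes "inj_on t {..<n}" "S \<in> patterns n"
  shows "cond_prob q (constraint_at n t S) W f =
    real (card {\<pi> \<in> S. \<forall>i<n. t i \<in> W \<longrightarrow> \<pi> i = f (t i)}) / real q ^ card {i. i < n \<and> t i \<notin> W}"
proof -
  have S: "S \<subseteq> colourings q {..<n}" "S \<noteq> {}" using assms(2) by (simp_all add: patterns_def)
  have dom: "constraint_dom (constraint_at n t S) = t ` {..<n}"
    by (rule constraint_dom_at[OF S(2)])
  have "(\<forall>x\<in>t ` {..<n} \<inter> W. placed n t \<pi> x = Some (f x)) \<longleftrightarrow> (\<forall>i<n. t i \<in> W \<longrightarrow> \<pi> i = f (t i))" for \<pi>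
  proof -
    have "(\<forall>x\<in>t ` {..<n} \<inter> W. placed n t \<pi> x = Some (f x)) \<longleftrightarrow>
        (\<forall>i<n. t i \<in> W \<longrightarrow> placed n t \<pi> (t i) = Some (f (t i)))" by blast
    then show ?thesis using placed_nth[OF assms(1), of _ \<pi>] by simp
  qed
  then have "agreeing (constraint_at n t S) W f =
      placed n t ` {\<pi> \<in> S. \<forall>i<n. t i \<in> W \<longrightarrow> \<pi> i = f (t i)}"
    unfolding agreeing_def dom unfolding constraint_at_def by blast
  moreover have "inj_on (placed n t) {\<pi> \<in> S. \<forall>i<n. t i \<in> W \<longrightarrow> \<pi> i = f (t i)}"
  proof (rule inj_onI)
    fix \<pi> \<pi>' assume a: "\<pi> \<in> {\<pi> \<in> S. \<forall>i<n. t i \<in> W \<longrightarrow> \<pi> i = f (t i)}"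
      "\<pi>' \<in> {\<pi> \<in> S. \<forall>i<n. t i \<in> W \<longrightarrow> \<pi> i = f (t i)}" "placed n t \<pi> = placed n t \<pi>'"
    then have "\<pi> \<in> extensional {..<n}" "\<pi>' \<in> extensional {..<n}" using S(1) by (auto simp: PiE_iff)
    then show "\<pi> = \<pi>'" using placed_eq_iff[OF assms(1)] a(3) by blast
  qed
  moreover have "t ` {..<n} - W = t ` {i. i < n \<and> t i \<notin> W}" by blast
  moreover have "inj_on t {i. i < n \<and> t i \<notin> W}"
    using assms(1) by (rule inj_on_subset) auto
  ultimately show ?thesis
    unfolding cond_prob_def dom by (simp add: card_image)
qed

text \<open>
  For a fixed set of patterns, the conditional probability at a tuple is a function of a finite list
  recording which entries lie in \<open>W\<close> and which colours they have. The list takes countably many values,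
  each on a Borel set.
\<close>

lemma cond_prob_borel:
  assumes W: "W \<in> sets M" and g: "g \<in> M \<rightarrow>\<^sub>M count_space {..<q}" and S: "S \<in> patterns n"
  shows "{t \<in> placements n S. cond_prob q (constraint_at n t S) W g \<ge> \<sigma>} \<in> sets (PiM {..<n} (\<lambda>_. M))"
proof -
  let ?P = "PiM {..<n} (\<lambda>_. M)"
  define F where "F z = real (card {\<pi> \<in> S. \<forall>i<n. fst (z ! i) \<longrightarrow> \<pi> i = snd (z ! i)})
    / real q ^ card {i. i < n \<and> \<not> fst (z ! i)}" for z :: "(bool \<times> nat) list"
  define e where "e t = map (\<lambda>i. (t i \<in> W, g (t i))) [0..<n]" for t :: "nat \<Rightarrow> 'a"
  have g': "g \<in> M \<rightarrow>\<^sub>M count_space UNIV"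
    using g by (rule measurable_compose) simp
  have coord: "(\<lambda>t. t i) \<in> ?P \<rightarrow>\<^sub>M M" if "i < n" for i
    by (rule measurable_component_singleton) (use that in simp)
  have piece: "{t \<in> space ?P. (t i \<in> W, g (t i)) = z} \<in> sets ?P" if "i < n" for i z
  proof -
    have "(if fst z then W else space M - W) \<inter> (g -` {snd z} \<inter> space M) \<in> sets M"
      using W measurable_sets[OF g', of "{snd z}"] by auto
    then have "(\<lambda>t. t i) -` ((if fst z then W else space M - W) \<inter> (g -` {snd z} \<inter> space M)) \<inter> space ?P \<in> sets ?P"
      by (rule measurable_sets[OF coord[OF that]])
    also have "(\<lambda>t. t i) -` ((if fst z then W else space M - W) \<inter> (g -` {snd z} \<inter> space M)) \<inter> space ?P =
        {t \<in> space ?P. (t i \<in> W, g (t i)) = z}"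
      using measurable_space[OF coord[OF that]] by (cases z) auto
    finally show ?thesis .
  qed
  have level: "{t \<in> space ?P. e t = z} \<in> sets ?P" for z
  proof (cases "length z = n")
    case True
    then have "{t \<in> space ?P. e t = z} = space ?P \<inter> (\<Inter>i\<in>{..<n}. {t \<in> space ?P. (t i \<in> W, g (t i)) = z ! i})"
      by (auto simp: e_def list_eq_iff_nth_eq)
    moreover have "(\<Inter>i\<in>{..<n}. {t \<in> space ?P. (t i \<in> W, g (t i)) = z ! i}) \<in> sets ?P" if "n \<noteq> 0"
      using that piece by (intro sets.finite_INT) auto
    ultimately show ?thesis by (cases "n = 0") auto
  next
    case False
    then have "{t \<in> space ?P. e t = z} = {}" by (auto simp: e_def)
    then show ?thesis by (simp only: sets.empty_sets)
  qed
  have "{t \<in> placements n S. cond_prob q (constraint_at n t S) W g \<ge> \<sigma>} =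
      placements n S \<inter> (\<Union>z\<in>{z. F z \<ge> \<sigma>}. {t \<in> space ?P. e t = z})"
  proof -
    have "cond_prob q (constraint_at n t S) W g = F (e t)" if "t \<in> placements n S" for t
      using cond_prob_constraint_at[OF placementsD(3)[OF that S] S, of W g]
      by (simp add: F_def e_def cong: conj_cong)
    moreover have "t \<in> space ?P" if "t \<in> placements n S" for t
      using that by (simp add: placements_def)
    ultimately show ?thesis by auto
  qed
  moreover have "(\<Union>z\<in>{z. F z \<ge> \<sigma>}. {t \<in> space ?P. e t = z}) \<in> sets ?P"
    by (intro sets.countable_UN'' level) (rule countableI_type)
  ultimately show ?thesis using placements_borel[OF S] by auto
qed

text \<open>
  Revealing the colours on one more component-finite part costs a factor \<open>\<tau>\<close> in the bound on the
  conditional probabilities. Constraints that do not meet \<open>U\<close> keep their conditional probability, which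
  is below \<open>\<sigma>\<close> because \<open>\<tau> < 1\<close>.
\<close>

theorem colour_one_more_part:
  assumes W: "W \<in> sets M" and U: "U \<in> sets M" and disj: "U \<inter> W = {}"
    and fin: "component_finite U (induced (CSP_graph \<B>) U)"
    and f: "f \<in> M \<rightarrow>\<^sub>M count_space {..<q}" and "\<sigma> > 0"
    and small: "\<And>B. B \<in> \<B> \<Longrightarrow> cond_prob q B W f \<le> \<sigma> * \<tau>"
  shows "\<exists>f'. f' \<in> M \<rightarrow>\<^sub>M count_space {..<q} \<and> (\<forall>B\<in>\<B>. cond_prob q B (W \<union> U) f' < \<sigma>)"
proof -
  have combine: "combine W f h \<in> M \<rightarrow>\<^sub>M count_space {..<q}" if "h \<in> M \<rightarrow>\<^sub>M count_space {..<q}" for h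
    unfolding combine_def using f that W by (intro measurable_If) simp_all
  define bad where "bad B h \<longleftrightarrow> cond_prob q B (W \<union> U) (combine W f h) \<ge> \<sigma>" for B h
  have "\<exists>h. h \<in> M \<rightarrow>\<^sub>M count_space {..<q} \<and>
      (\<forall>B\<in>\<B>. constraint_dom B \<inter> U \<noteq> {} \<longrightarrow> \<not> bad B h)"
  proof (rule borel_choice_on_finite_components[OF U fin])
    show "depends_on (constraint_dom B \<inter> U) (bad B)" for B
      unfolding depends_on_def
    proof (intro allI impI)
      fix h h' :: "'a \<Rightarrow> nat" assume eq: "\<forall>x\<in>constraint_dom B \<inter> U. h x = h' x"
      have "cond_prob q B (W \<union> U) (combine W f h) = cond_prob q B (W \<union> U) (combine W f h')"
        by (rule cond_prob_cong) (use eq in \<open>auto simp: combine_def\<close>)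
      then show "bad B h = bad B h'" by (simp add: bad_def)
    qed
    show "{t \<in> placements n S. bad (constraint_at n t S) h} \<in> sets (PiM {..<n} (\<lambda>_. M))"
      if "h \<in> M \<rightarrow>\<^sub>M count_space {..<q}" "S \<in> patterns n" for h n S
      unfolding bad_def using W U that by (intro cond_prob_borel combine sets.Un)
    show "\<exists>h. (\<forall>x\<in>V. h x < q) \<and> (\<forall>B\<in>\<B>. constraint_dom B \<inter> U \<noteq> {} \<longrightarrow>
        constraint_dom B \<inter> U \<subseteq> V \<longrightarrow> \<not> bad B h)" if "finite V" "V \<subseteq> U" for V
      unfolding bad_def by (rule component_colouring[OF that disj \<open>\<sigma> > 0\<close> small])
  qed
  then obtain h where h: "h \<in> M \<rightarrow>\<^sub>M count_space {..<q}"
    "\<forall>B\<in>\<B>. constraint_dom B \<inter> U \<noteq> {} \<longrightarrow> \<not> bad B h" by blast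
  have "cond_prob q B (W \<union> U) (combine W f h) < \<sigma>" if B: "B \<in> \<B>" for B
  proof (cases "constraint_dom B \<inter> U = {}")
    case True
    have "cond_prob q B (W \<union> U) (combine W f h) = cond_prob q B W f"
    proof -
      have "constraint_dom B \<inter> (W \<union> U) = constraint_dom B \<inter> W" "constraint_dom B - (W \<union> U) = constraint_dom B - W"
        using True by blast+
      moreover have "agreeing B W (combine W f h) = agreeing B W f"
        by (rule agreeing_cong) (simp add: combine_def)
      ultimately show ?thesis unfolding cond_prob_def agreeing_def by simp
    qed
    also have "\<dots> \<le> \<sigma> * \<tau>" by (rule small[OF B])
    also have "\<dots> < \<sigma> * 1" using \<tau>_bounds(2) \<open>\<sigma> > 0\<close> by (rule mult_strict_left_mono)
    finally show ?thesis by simp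
  next
    case False
    then show ?thesis using h(2) B unfolding bad_def by fastforce
  qed
  then show ?thesis using combine[OF h(1)] by blast
qed

lemma not_violated:
  assumes "B \<in> \<B>" "constraint_dom B \<subseteq> W" "cond_prob q B W f < 1"
  shows "\<not> violates f B"
proof
  assume "violates f B"
  then have p: "(Some \<circ> f) |` constraint_dom B \<in> B" by (simp add: violates_def)
  then have "(Some \<circ> f) |` constraint_dom B \<in> agreeing B W f"
    by (simp add: agreeing_def)
  moreover have "finite (agreeing B W f)"
    using finite_constraint[OF assms(1)] by (simp add: agreeing_def)
  ultimately have "card (agreeing B W f) \<ge> 1"
    by (metis One_nat_def Suc_leI card_gt_0_iff empty_iff)
  moreover have "card (constraint_dom B - W) = 0"
    using assms(2) by (metis Diff_eq_empty_iff card.empty)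
  ultimately show False using assms(3) unfolding cond_prob_def by simp
qed

theorem borel_solution_two_parts:
  assumes U: "U \<in> sets M" "U' \<in> sets M" "U \<inter> U' = {}" "U \<union> U' = space M"
    and fin: "component_finite U (induced (CSP_graph \<B>) U)" "component_finite U' (induced (CSP_graph \<B>) U')"
    and prob: "\<And>B. B \<in> \<B> \<Longrightarrow> constraint_prob q B * (\<delta> + 1)\<^sup>2 \<le> exp (-2)"
  shows "\<exists>f. borel_solution M q \<B> f"
proof -
  have small: "constraint_prob q B \<le> \<tau> * \<tau>" if "B \<in> \<B>" for B
  proof -
    have "\<tau> * \<tau> = exp (-2) / (\<delta> + 1)\<^sup>2"
      by (simp add: \<tau>_def power2_eq_square mult_exp_exp)
    then show ?thesis using prob[OF that] \<delta> by (simp add: pos_le_divide_eq)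
  qed
  have "(\<lambda>_. 0) \<in> M \<rightarrow>\<^sub>M count_space {..<q}" using q by simp
  then obtain f where f: "f \<in> M \<rightarrow>\<^sub>M count_space {..<q}" "\<forall>B\<in>\<B>. cond_prob q B ({} \<union> U) f < \<tau>"
    using colour_one_more_part[of "{}" U "\<lambda>_. 0" \<tau>] U fin(1) \<tau>_bounds(1) small
    by (auto simp: cond_prob_empty)
  have "\<exists>g. g \<in> M \<rightarrow>\<^sub>M count_space {..<q} \<and> (\<forall>B\<in>\<B>. cond_prob q B (U \<union> U') g < 1)"
  proof (rule colour_one_more_part[OF U(1,2) _ fin(2) f(1)])
    show "cond_prob q B U f \<le> 1 * \<tau>" if "B \<in> \<B>" for B using f(2) that by (simp add: less_imp_le)
  qed (use U(3) in auto)
  then obtain g where g: "g \<in> M \<rightarrow>\<^sub>M count_space {..<q}" "\<forall>B\<in>\<B>. cond_prob q B (space M) g < 1"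
    unfolding U(4) by blast
  then have "borel_solution M q \<B> g"
    unfolding borel_solution_def using not_violated dom_subset by blast
  then show ?thesis by blast
qed

end

text \<open>
  An index of \<open>0\<close> is turned into two parts by adding the empty set.
\<close>

lemma separation_index_le_1:
  assumes "separation_index M E \<le> 1"
  obtains U U' where "U \<in> sets M" "U' \<in> sets M" "U \<inter> U' = {}" "U \<union> U' = space M"
    "component_finite U (induced E U)" "component_finite U' (induced E U')"
proof -
  let ?P = "\<lambda>s U. (\<forall>i\<le>s. U i \<in> sets M) \<and> disjoint_family_on U {..s} \<and> (\<Union>i\<le>s. U i) = space M \<and>
    (\<forall>i\<le>s. component_finite (U i) (induced E (U i)))"
  let ?I = "{s. \<exists>U. ?P s U}"
  have le: "(INF s\<in>?I. enat s) \<le> 1" using assms by (simp add: separation_index_def)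
  have "enat ` ?I \<noteq> {}"
  proof
    assume "enat ` ?I = {}"
    then have "(INF s\<in>?I. enat s) = \<infinity>" by (simp only: Inf_empty top_enat_def)
    then show False using le by simp
  qed
  then have "Inf (enat ` ?I) \<in> enat ` ?I"
    by (rule wellorder_InfI[OF ex_in_conv[THEN iffD2, THEN someI_ex]])
  then obtain s U where s: "enat s \<le> 1" "?P s U" using le by auto
  have s1: "s = 0 \<or> s = 1" using s(1) by (cases s) (auto simp: one_enat_def)
  then show thesis
  proof
    assume "s = 0"
    then show thesis using s(2) by (intro that[of "U 0" "{}"]) (auto simp: component_finite_def)
  next
    assume [simp]: "s = 1"
    have eq: "{..s} = {0, 1}" by auto
    have "U 0 \<inter> U 1 = {}" using s(2) unfolding eq by (auto simp: disjoint_family_on_def)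
    moreover have "U 0 \<union> U 1 = space M" using s(2) unfolding eq by auto
    ultimately show thesis using s(2) by (intro that[of "U 0" "U 1"]) auto
  qed
qed

lemma graph_power_1: "graph_power (CSP_graph \<B>) 1 = CSP_graph \<B>"
proof -
  have "(x, y) \<in> graph_power (CSP_graph \<B>) 1 \<longleftrightarrow> (x, y) \<in> CSP_graph \<B>" for x y
  proof
    assume "(x, y) \<in> graph_power (CSP_graph \<B>) 1"
    then obtain n where n: "x \<noteq> y" "n \<le> 1" "(x, y) \<in> CSP_graph \<B> ^^ n"
      unfolding graph_power_def by blast
    then have "n \<noteq> 0" by (intro notI) simp
    then have "n = 1" using n(2) by simp
    then show "(x, y) \<in> CSP_graph \<B>" using n(3) by simp
  next
    assume xy: "(x, y) \<in> CSP_graph \<B>"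
    then have "x \<noteq> y" by (simp add: CSP_graph_def)
    moreover have "(x, y) \<in> CSP_graph \<B> ^^ 1" using xy by simp
    ultimately show "(x, y) \<in> graph_power (CSP_graph \<B>) 1" unfolding graph_power_def by blast
  qed
  then show ?thesis by auto
qed

theorem corollary1p30:
  fixes M :: "'a measure" and q :: nat and \<B> :: "('a \<rightharpoonup> nat) set set"
  assumes "standard_borel M"
    and "q > 0"
    and "borel_CSP M q \<B>"
    and "asymptotic_separation_index M (CSP_graph \<B>) \<le> 1"
    and "CSP_d \<B> < \<infinity>"
    and "CSP_p q \<B> * (CSP_d \<B> + 1)\<^sup>2 \<le> ennreal (exp (-2))"
  shows "\<exists>f. borel_solution M q \<B> f"
proof -
  define \<delta> where "\<delta> = enn2real (CSP_d \<B>)"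
  have d: "CSP_d \<B> = ennreal \<delta>" "\<delta> \<ge> 0" using assms(5) by (simp_all add: \<delta>_def less_top)
  interpret borel_CSP_bounded_degree M q \<B> \<delta>
  proof
    fix B assume B: "B \<in> \<B>"
    let ?N = "{B' \<in> \<B>. B' \<noteq> B \<and> constraint_dom B' \<inter> constraint_dom B \<noteq> {}}"
    have le: "emeasure (count_space UNIV) ?N \<le> ennreal \<delta>"
      unfolding d(1)[symmetric] CSP_d_def using B by (rule SUP_upper)
    have "finite ?N"
    proof (rule ccontr)
      assume "infinite ?N"
      then have "emeasure (count_space UNIV) ?N = \<infinity>" by (simp add: emeasure_count_space_infinite)
      then show False using le by (simp add: top_unique)
    qed
    moreover then have "ennreal (real (card ?N)) \<le> ennreal \<delta>"
      using le by (simp add: emeasure_count_space_finite ennreal_of_nat_eq_real_of_nat)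
    ultimately show "finite ?N \<and> real (card ?N) \<le> \<delta>" using d(2) by (simp add: ennreal_le_iff)
  qed (use assms d in auto)
  have "separation_index M (graph_power (CSP_graph \<B>) 1) \<le> asymptotic_separation_index M (CSP_graph \<B>)"
    unfolding asymptotic_separation_index_def by (rule SUP_upper) simp
  then have "separation_index M (CSP_graph \<B>) \<le> 1"
    using assms(4) unfolding graph_power_1 by (rule order_trans)
  then obtain U U' where U: "U \<in> sets M" "U' \<in> sets M" "U \<inter> U' = {}" "U \<union> U' = space M"
    "component_finite U (induced (CSP_graph \<B>) U)" "component_finite U' (induced (CSP_graph \<B>) U')"
    by (rule separation_index_le_1)
  show ?thesis
  proof (rule borel_solution_two_parts[OF U])
    fix B assume B: "B \<in> \<B>"
    have nn: "0 \<le> constraint_prob q B" by (simp add: constraint_prob_def)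
    have "ennreal (constraint_prob q B) \<le> CSP_p q \<B>"
      unfolding CSP_p_def using B by (rule SUP_upper)
    then have "ennreal (constraint_prob q B) * (ennreal \<delta> + 1)\<^sup>2 \<le> CSP_p q \<B> * (ennreal \<delta> + 1)\<^sup>2"
      by (rule mult_right_mono) simp
    then have "ennreal (constraint_prob q B) * (ennreal \<delta> + 1)\<^sup>2 \<le> ennreal (exp (-2))"
      using assms(6) unfolding d(1) by (rule order_trans)
    also have "(ennreal \<delta> + 1)\<^sup>2 = ennreal ((\<delta> + 1)\<^sup>2)"
      using d(2) by (simp add: ennreal_power[symmetric] ennreal_plus)
    also have "ennreal (constraint_prob q B) * \<dots> = ennreal (constraint_prob q B * (\<delta> + 1)\<^sup>2)"
      using nn by (simp add: ennreal_mult)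
    finally show "constraint_prob q B * (\<delta> + 1)\<^sup>2 \<le> exp (-2)" by (simp add: ennreal_le_iff)
  qed
qed

end
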